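(* For every completely pivoted real $5\times5$ matrix $A$, $g(A)\le 4.84$. (Equivalently, the growth factor of Gaussian elimination with complete pivoting on any real $5\times 5$ matrix is at most $4.84$.)
   Context: For a real $n\times n$ matrix $A$ and $k=1,\dots,n$, set $A^{(k)} := A_{k:n,k:n} - A_{k:n,1:k-1}\,[A_{1:k-1,1:k-1}]^{-1} A_{1:k-1,k:n}$, where $A_{i:j,k:\ell}$ is the submatrix with rows $i,\dots,j$ and columns $k,\dots,\ell$; entries of $A^{(k)}$ are indexed by $i,j\in\{k,\dots,n\}$ ($A^{(k)}$ is the matrix remaining after $k-1$ steps of Gaussian elimination; relevant leading principal submatrices are assumed invertible). $A$ is completely pivoted if $|A^{(k)}_{i,j}|\le|A^{(k)}_{k,k}|$ for all $i,j=k,\dots,n$, $k=1,\dots,n-1$. For completely pivoted $A=LU$ ($L$ unit lower triangular, $U$ upper triangular) the growth factor is $g(A)=\max\{\|L\|_{\max},\|U\|_{\max}/\|A\|_{\max}\}$, where $\|\cdot\|_{\max}$ is the largest absolute value of an entry. *)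

theory Defs
  imports "Jordan_Normal_Form.Matrix"
begin

definition subm :: "'a mat \<Rightarrow> nat \<Rightarrow> nat \<Rightarrow> nat \<Rightarrow> nat \<Rightarrow> 'a mat" where
  "subm A r0 r1 c0 c1 = mat (r1 - r0) (c1 - c0) (\<lambda>(i,j). A $$ (r0 + i, c0 + j))"

(* Inverse of a square matrix (meaningful when the matrix is invertible). *)
definition mat_inv :: "real mat \<Rightarrow> real mat" where
  "mat_inv M = (SOME B. B \<in> carrier_mat (dim_row M) (dim_row M) \<and>
                        M * B = 1\<^sub>m (dim_row M) \<and> B * M = 1\<^sub>m (dim_row M))"

(* schur A k is the paper's A^(k+1) (0-based: k elimination steps done):
   A_{k+1:n,k+1:n} - A_{k+1:n,1:k} [A_{1:k,1:k}]^{-1} A_{1:k,k+1:n}.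
   Its entry (i,j) is the paper's entry (k+1+i, k+1+j). *)
definition schur :: "real mat \<Rightarrow> nat \<Rightarrow> real mat" where
  "schur A k = (let n = dim_row A in
     subm A k n k n - subm A k n 0 k * mat_inv (subm A 0 k 0 k) * subm A 0 k k n)"

definition leading_minors_invertible :: "real mat \<Rightarrow> bool" where
  "leading_minors_invertible A \<longleftrightarrow>
     (\<forall>m. 1 \<le> m \<and> m < dim_row A \<longrightarrow> invertible_mat (subm A 0 m 0 m))"

definition completely_pivoted :: "real mat \<Rightarrow> bool" where
  "completely_pivoted A \<longleftrightarrow>
     (\<forall>k. k + 1 < dim_row A \<longrightarrow>
        (\<forall>i j. i < dim_row A - k \<and> j < dim_row A - k \<longrightarrow>
           \<bar>schur A k $$ (i,j)\<bar> \<le> \<bar>schur A k $$ (0,0)\<bar>))"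

definition unit_lower_triangular :: "real mat \<Rightarrow> bool" where
  "unit_lower_triangular L \<longleftrightarrow>
     (\<forall>i < dim_row L. L $$ (i,i) = 1 \<and> (\<forall>j. i < j \<and> j < dim_col L \<longrightarrow> L $$ (i,j) = 0))"

definition max_norm :: "real mat \<Rightarrow> real" where
  "max_norm M = Max {\<bar>M $$ (i,j)\<bar> | i j. i < dim_row M \<and> j < dim_col M}"

definition growth_factor :: "real mat \<Rightarrow> real mat \<Rightarrow> real mat \<Rightarrow> real" where
  "growth_factor A L U = max (max_norm L) (max_norm U / max_norm A)"

end

theory Submission
  imports Defs "Jordan_Normal_Form.Determinant"
begin

text \<open>
  Write \<open>p\<^sub>1, \<dots>, p\<^sub>5\<close> for the absolute pivots. For a \<open>3 \<times> 3\<close> matrix the third pivot is at most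
  \<open>3 r - r\<^sup>2 \<le> 9/4\<close> times the first one, where \<open>r \<ge> 1\<close> is the ratio of the second to the first. Hence
  \<open>p\<^sub>5 \<le> 9/4 p\<^sub>3\<close> and \<open>p\<^sub>3 \<le> 9/4 p\<^sub>1\<close>, and it remains to exclude that both bounds are nearly sharp.
  If the second one is, then every \<open>2 \<times> 2\<close> block with entries \<open>a, b, c, d\<close> of negative product in the
  Schur complement after two steps satisfies \<open>3 (\<bar>a\<bar> + \<bar>b\<bar> + \<bar>c\<bar>) + \<bar>d\<bar> \<le> 81/4 p\<^sub>1\<close>, while a large
  \<open>p\<^sub>5 / p\<^sub>3\<close> requires such blocks with three entries close to \<open>p\<^sub>3\<close> and a fourth one that is not small.
  Both the block inequality and its incompatibility with \<open>p\<^sub>5 > 4.84 p\<^sub>1\<close> are infeasibility statements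
  for quadratic systems on a box. They are proved by branch and bound; each leaf carries the dual
  solution of the linear programme obtained by McCormick relaxation of the products.
\<close>

section \<open>Certificates for quadratic systems on a box\<close>

text \<open>Applying the 3 by 3 bound twice gives only (9/4)^2 = 5.0625, so the two halves of the
  elimination have to be coupled. The block inequality is that coupling. For fixed signs it is
  linear in the entries of the second Schur complement, so besides pivoting and the range of p3/p1
  it is all that passes from the first two steps to the last two, and each quadratic system keeps at
  most fifteen variables. Its constant 81/4 is nine times 9/4: three entries of the extreme size 9/4
  p1 leave no room for the fourth. The threshold 4.84 fixes the working range. If p5 > 4.84 p1, then
  p5 \<le> 9/4 p3 gives p3 > 484/225 p1, because 4.84 * 4/9 = 484/225. Hence p1/p3 lies between 4/9
  and 225/484 < 42/90, and r = p2/p1, for which 3 r - r^2 > 484/225, lies between 71/60 and 109/60.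
  The denominators 60 and 90 of these rounded bounds are the scales of the two integer
  boxes.\<close>

text \<open>
  A certificate is a subdivision of an integer box. At a leaf, a nonnegative combination of the
  constraints (first list) is bounded above by a negative number: every product is replaced by a
  mixture of its two McCormick estimates (the second list holds the share of the first estimate),
  and the resulting linear form is maximised over the box.
\<close>

datatype cert = Leaf "int list" "int list" | Split nat int cert cert

text \<open>The longer list is cut off, so a coefficient list stands for its extension by zeros. The
  constraint rows may therefore stop at their last nonzero coefficient, and \<open>axpy\<close> and
  \<open>add_at\<close> supply missing positions.\<close>

fun dot :: "int list \<Rightarrow> real list \<Rightarrow> real" where
  "dot (a # as) (x # xs) = of_int a * x + dot as xs"
| "dot _ _ = 0"

definition products :: "(nat \<times> nat) list \<Rightarrow> real list \<Rightarrow> real list" where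
  "products ps xs = map (\<lambda>(i, j). xs ! i * xs ! j) ps"

text \<open>The coefficient order is constant, variables, products. A quadratic form becomes a
  scalar product with one long vector, so combining constraints is linear algebra on coefficient
  lists.\<close>

definition quad_eval :: "(nat \<times> nat) list \<Rightarrow> int list \<Rightarrow> real list \<Rightarrow> real" where
  "quad_eval ps c xs = dot c (1 # xs @ products ps xs)"

text \<open>Integer endpoints keep the whole check in integer arithmetic; rational ranges are
  reached by scaling the variables beforehand. The point itself stays real.\<close>

definition in_box :: "(int \<times> int) list \<Rightarrow> real list \<Rightarrow> bool" where
  "in_box bx xs \<longleftrightarrow> list_all2 (\<lambda>b x. of_int (fst b) \<le> x \<and> x \<le> of_int (snd b)) bx xs"

fun axpy :: "int \<Rightarrow> int list \<Rightarrow> int list \<Rightarrow> int list" where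
  "axpy c (x # xs) (y # ys) = (c * x + y) # axpy c xs ys"
| "axpy c [] ys = ys"
| "axpy c (x # xs) [] = c * x # axpy c xs []"

fun combination :: "int list \<Rightarrow> int list list \<Rightarrow> int list \<Rightarrow> int list" where
  "combination (m # ms) (c # cs) acc =
     combination ms cs (if m = 0 then acc else axpy m c acc)"
| "combination [] cs acc = acc"
| "combination (m # ms) [] acc = acc"

fun add_at :: "nat \<Rightarrow> int \<Rightarrow> int list \<Rightarrow> int list" where
  "add_at 0 c (x # xs) = (c + x) # xs"
| "add_at (Suc i) c (x # xs) = x # add_at i c xs"
| "add_at 0 c [] = [c]"
| "add_at (Suc i) c [] = 0 # add_at i c []"

text \<open>The result is constant, coefficient of x, coefficient of y of an affine upper bound for
  g * x * y. Each estimate says that a product of distances from two faces of the box is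
  nonnegative. Clamping \<open>t\<close> between 0 and \<open>g\<close> gives both shares the sign
  of \<open>g\<close>, so any \<open>t\<close> yields a valid bound.\<close>

definition mccormick :: "int \<Rightarrow> int \<Rightarrow> int \<times> int \<Rightarrow> int \<times> int \<Rightarrow> int \<times> int \<times> int" where
  "mccormick g t bi bj = (case bi of (li, hi) \<Rightarrow> case bj of (lj, hj) \<Rightarrow>
     if 0 \<le> g then
       (let t = max 0 (min t g); u = g - t
        in (- (t * hi * lj) - u * li * hj, t * lj + u * hj, t * hi + u * li))
     else
       (let t = min 0 (max t g); u = g - t
        in (- (t * li * lj) - u * hi * hj, t * lj + u * hj, t * li + u * hi)))"

text \<open>A missing share counts as 0, that is, only the second estimate is used. A product with
  coefficient 0 still consumes its share, which keeps \<open>ts\<close> aligned with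
  \<open>ps\<close>.\<close>

fun linearise :: "(int \<times> int) list \<Rightarrow> (nat \<times> nat) list \<Rightarrow> int list \<Rightarrow> int list \<Rightarrow> int \<Rightarrow> int list
    \<Rightarrow> int \<times> int list" where
  "linearise bx ((i, j) # ps) ts (g # gs) c v =
    (if g = 0 then linearise bx ps (tl ts) gs c v else
     case mccormick g (case ts of [] \<Rightarrow> 0 | t # _ \<Rightarrow> t) (bx ! i) (bx ! j) of (c', a, b) \<Rightarrow>
       linearise bx ps (tl ts) gs (c + c') (add_at i a (add_at j b v)))"
| "linearise bx _ ts _ c v = (c, v)"

fun box_max :: "(int \<times> int) list \<Rightarrow> int list \<Rightarrow> int" where
  "box_max ((l, h) # bx) (g # gs) = (if 0 \<le> g then g * h else g * l) + box_max bx gs"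
| "box_max _ _ = 0"

fun check :: "(nat \<times> nat) list \<Rightarrow> int list list \<Rightarrow> (int \<times> int) list \<Rightarrow> cert \<Rightarrow> bool" where
  "check ps cs bx (Leaf ms ts) = (list_all ((\<le>) 0) ms \<and>
     (case combination ms cs [] of c # v \<Rightarrow>
        (case linearise bx ps ts (drop (length bx) v) c (take (length bx) v) of
           (c', v') \<Rightarrow> c' + box_max bx v' < 0)
      | [] \<Rightarrow> False))"
| "check ps cs bx (Split i m t1 t2) =
     (check ps cs (bx[i := (fst (bx ! i), m)]) t1 \<and> check ps cs (bx[i := (m, snd (bx ! i))]) t2)"

section \<open>Soundness of the check\<close>

lemma dot_Nil2 [simp]: "dot v [] = 0"
  by (cases v) auto

lemma dot_axpy: "dot (axpy c v w) xs = of_int c * dot v xs + dot w xs"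
proof (induction c v w arbitrary: xs rule: axpy.induct)
  case (1 c x xs y ys zs) then show ?case by (cases zs) (auto simp: algebra_simps)
next
  case (3 c x xs zs) then show ?case by (cases zs) (auto simp: algebra_simps)
qed auto

lemma dot_append: "dot v (xs @ ys) = dot (take (length xs) v) xs + dot (drop (length xs) v) ys"
  by (induction v xs rule: dot.induct) auto

lemma dot_add_at: "i < length xs \<Longrightarrow> dot (add_at i c v) xs = dot v xs + of_int c * xs ! i"
proof (induction i c v arbitrary: xs rule: add_at.induct)
  case (1 c x xs ys) then show ?case by (cases ys) (auto simp: algebra_simps)
next
  case (2 i c x xs ys) then show ?case by (cases ys) auto
next
  case (3 c ys) then show ?case by (cases ys) auto
next
  case (4 i c ys) then show ?case by (cases ys) auto
qed

lemma combination_nonneg: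
  assumes "\<forall>c\<in>set cs. 0 \<le> dot c ys" "list_all ((\<le>) 0) ms" "0 \<le> dot acc ys"
  shows "0 \<le> dot (combination ms cs acc) ys"
  using assms
  by (induction ms cs acc rule: combination.induct) (auto simp: dot_axpy)

lemma mccormick_bound:
  fixes x y :: real
  assumes "mccormick g t (li, hi) (lj, hj) = (c, a, b)"
    and "of_int li \<le> x" "x \<le> of_int hi" "of_int lj \<le> y" "y \<le> of_int hj"
  shows "of_int g * (x * y) \<le> of_int c + of_int a * x + of_int b * y"
proof (cases "0 \<le> g")
  case True
  define s where "s = max 0 (min t g)"
  have s: "0 \<le> s" "0 \<le> g - s" using True by (auto simp: s_def)
  \<comment> \<open>Expanding these two products of distances from faces gives exactly the claimed
    difference.\<close>
  have *: "0 \<le> of_int s * ((of_int hi - x) * (y - of_int lj))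
          + of_int (g - s) * ((x - of_int li) * (of_int hj - y))"
    using assms(2-) s by (intro add_nonneg_nonneg mult_nonneg_nonneg) auto
  have eqs: "c = - (s * hi * lj) - (g - s) * li * hj" "a = s * lj + (g - s) * hj"
      "b = s * hi + (g - s) * li"
    using assms(1) True by (auto simp: mccormick_def Let_def s_def)
  show ?thesis unfolding eqs using * by (simp add: algebra_simps)
next
  case False
  define s where "s = min 0 (max t g)"
  have s: "0 \<le> - s" "0 \<le> - (g - s)" using False by (auto simp: s_def)
  have *: "0 \<le> of_int (- s) * ((x - of_int li) * (y - of_int lj))
          + of_int (- (g - s)) * ((of_int hi - x) * (of_int hj - y))"
    using assms(2-) s by (intro add_nonneg_nonneg mult_nonneg_nonneg) auto
  have eqs: "c = - (s * li * lj) - (g - s) * hi * hj" "a = s * lj + (g - s) * hj"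
      "b = s * li + (g - s) * hi"
    using assms(1) False by (auto simp: mccormick_def Let_def s_def)
  show ?thesis unfolding eqs using * by (simp add: algebra_simps)
qed

lemma in_box_nth:
  "in_box bx xs \<Longrightarrow> i < length xs \<Longrightarrow> of_int (fst (bx ! i)) \<le> xs ! i \<and> xs ! i \<le> of_int (snd (bx ! i))"
  by (auto simp: in_box_def list_all2_conv_all_nth)

text \<open>The pair \<open>c\<close>, \<open>v\<close> accumulates the affine part found so far,
  while \<open>gs\<close> holds the products not yet replaced; every replacement can only increase
  the total.\<close>

lemma linearise_bound:
  assumes "in_box bx xs" "\<forall>(i, j)\<in>set ps. i < length xs \<and> j < length xs"
    and "linearise bx ps ts gs c v = (c', v')"
  shows "of_int c + dot v xs + dot gs (products ps xs) \<le> of_int c' + dot v' xs"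
  using assms
proof (induction bx ps ts gs c v rule: linearise.induct)
  case (1 bx i j ps ts g gs c v)
  show ?case
  proof (cases "g = 0")
    case True
    with 1 show ?thesis by (auto simp: products_def)
  next
    case False
    obtain d a b where m: "mccormick g (case ts of [] \<Rightarrow> 0 | t # _ \<Rightarrow> t) (bx ! i) (bx ! j) = (d, a, b)"
      by (cases "mccormick g (case ts of [] \<Rightarrow> 0 | t # _ \<Rightarrow> t) (bx ! i) (bx ! j)") auto
    have ij: "i < length xs" "j < length xs" using 1 by auto
    have "of_int g * (xs ! i * xs ! j) \<le> of_int d + of_int a * xs ! i + of_int b * xs ! j"
      using m in_box_nth[OF 1(3) ij(1)] in_box_nth[OF 1(3) ij(2)]
      by (intro mccormick_bound[of _ _ "fst (bx ! i)" "snd (bx ! i)" "fst (bx ! j)" "snd (bx ! j)"]) auto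
    moreover have "of_int (c + d) + dot (add_at i a (add_at j b v)) xs + dot gs (products ps xs)
        \<le> of_int c' + dot v' xs"
      using 1 False m by (intro "1.IH"(2)[OF False m[symmetric]]) auto
    ultimately show ?thesis using ij by (simp add: dot_add_at products_def)
  qed
qed (auto simp: products_def)

lemma box_max_bound: "in_box bx xs \<Longrightarrow> dot v xs \<le> of_int (box_max bx v)"
proof (induction bx v arbitrary: xs rule: box_max.induct)
  case (1 l h bx g gs)
  then obtain y ys where xs: "xs = y # ys" and y: "of_int l \<le> y" "y \<le> of_int h" and "in_box bx ys"
    by (auto simp: in_box_def list_all2_Cons1)
  then have "dot gs ys \<le> of_int (box_max bx gs)" using 1 by auto
  moreover have "of_int g * y \<le> of_int (if 0 \<le> g then g * h else g * l)"
    using y by (auto intro: mult_left_mono mult_left_mono_neg)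
  ultimately show ?case by (auto simp: xs)
qed (auto simp: in_box_def)

text \<open>The two children share the face at \<open>m\<close>, so they cover all real points.
  Nothing is assumed about \<open>m\<close>: on whichever side of it the coordinate lies, that child
  contains the point. An index outside the list leaves the box unchanged.\<close>

lemma in_box_update:
  assumes "in_box bx xs"
  shows "in_box (bx[i := (fst (bx ! i), m)]) xs \<or> in_box (bx[i := (m, snd (bx ! i))]) xs"
proof (cases "i < length xs")
  case True
  then show ?thesis
    using assms by (cases "xs ! i \<le> of_int m") (auto simp: in_box_def list_all2_conv_all_nth nth_list_update)
next
  case False
  then show ?thesis using assms by (auto simp: in_box_def list_all2_conv_all_nth list_update_beyond)
qed

text \<open>Certificates are untrusted data: multipliers are tested for nonnegativity, shares are
  clamped and split points are arbitrary, so the success of \<open>check\<close> alone excludes the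
  point.\<close>

theorem check_sound:
  assumes "check ps cs bx t" "in_box bx xs" "\<forall>(i, j)\<in>set ps. i < length xs \<and> j < length xs"
    and "\<forall>c\<in>set cs. 0 \<le> quad_eval ps c xs"
  shows False
  using assms
proof (induction ps cs bx t rule: check.induct)
  case (1 ps cs bx ms ts)
  have len: "length bx = length xs" using 1 by (auto simp: in_box_def list_all2_lengthD)
  let ?ys = "1 # xs @ products ps xs"
  obtain c v where cv: "combination ms cs [] = c # v" and m: "list_all ((\<le>) 0) ms"
    using 1 by (auto split: list.splits)
  obtain c' v' where e: "linearise bx ps ts (drop (length bx) v) c (take (length bx) v) = (c', v')"
    by (cases "linearise bx ps ts (drop (length bx) v) c (take (length bx) v)") auto
  have neg: "c' + box_max bx v' < 0" using 1 cv e by auto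
  have "0 \<le> dot (combination ms cs []) ?ys"
    using 1 m by (intro combination_nonneg) (auto simp: quad_eval_def)
  also have "\<dots> = of_int c + dot (take (length bx) v) xs + dot (drop (length bx) v) (products ps xs)"
    by (simp add: cv dot_append len)
  also have "\<dots> \<le> of_int c' + dot v' xs"
    using 1 e by (intro linearise_bound[of bx])
  also have "\<dots> \<le> of_int (c' + box_max bx v')"
    using box_max_bound[of bx xs v'] 1 by auto
  finally show False using neg by (simp only: of_int_0_le_iff)
next
  case (2 ps cs bx i m t1 t2)
  then show ?case using in_box_update[of bx xs i m] by auto
qed

section \<open>Certificates for the first two steps\<close>

text \<open>
  The variables, all scaled by 60, are \<open>r, u, v, b3, b4, a3, a4, x3, x4, q3, q4, B33, B34, B43, D44\<close>
  in the order in which they occur in \<open>level1_core\<close>, where the constraints are spelled out.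
\<close>

definition level1_products :: "(nat \<times> nat) list" where
  "level1_products =
    [(1, 2), (1, 3), (1, 4), (2, 5), (2, 6), (5, 3), (6, 3), (5, 4), (6, 4), (7, 9), (7, 10),
    (8, 9), (8, 10), (0, 9), (0, 10)]"

text \<open>The lower bound 11 for u and v comes from u v \<ge> r - 1 \<ge> 11/60. The range 120 of
  the last four variables only reflects r < 2; their sharper bound r is among the linear
  constraints.\<close>

definition level1_box :: "(int \<times> int) list" where
  "level1_box =
    [(71, 109), (11, 60), (11, 60), (-60, 60), (-60, 60), (-60, 60), (-60, 60), (0, 109), (0,
    109), (0, 60), (0, 60), (-120, 120), (-120, 120), (-120, 120), (-120, 120)]"

text \<open>After scaling by 60, constants carry the factor 3600, linear terms 60 and products 1.
  The last nine rows place three entries of the block below three tangents of the parabola 3 r -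
  r^2.\<close>

definition level1_constraints :: "int list list" where
  "level1_constraints =
   [[3600, -60, 0, 0, 0, 0, 0, 0, 0, 0, 0, 0, 0, 0, 0, 0, 1],
    [0, 60, 0, 0, 0, 0, 0, 0, -60],
    [3600, 0, 0, 0, 0, 0, 0, 0, -60, 0, 0, 0, 0, 0, 0, 0, 0, 1],
    [3600, 0, 0, 0, 0, 0, 0, 0, 0, 0, 0, 0, 0, 0, 0, 0, 0, 0, 0, 1, 0, 0, 0, 0, 0, 0, 0, 0, 0,
     -1],
    [0, 60, 0, 0, 0, 0, 0, 0, 0, -60],
    [3600, 0, 0, 0, 0, 0, 0, 0, 0, -60, 0, 0, 0, 0, 0, 0, 0, 0, 1],
    [3600, 0, 0, 0, 0, 0, 0, 0, 0, 0, 0, 0, 0, 0, 0, 0, 0, 0, 0, 0, 1, 0, 0, 0, 0, 0, 0, 0, 0,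
     0, -1],
    [0, 60, 0, 0, 0, 0, 0, 0, 0, 0, 0, 0, -60],
    [3600, 0, 0, 0, 0, 0, 0, 0, 0, 0, 0, 0, -60, 0, 0, 0, 0, 0, 0, 0, 0, -1],
    [0, 60, 0, 0, 0, 0, 0, 0, 0, 0, 0, 0, 0, -60],
    [3600, 0, 0, 0, 0, 0, 0, 0, 0, 0, 0, 0, 0, -60, 0, 0, 0, 0, 0, 0, 0, 0, -1],
    [0, 60, 0, 0, 0, 0, 0, 0, 0, 0, 0, 0, 0, 0, -60],
    [3600, 0, 0, 0, 0, 0, 0, 0, 0, 0, 0, 0, 0, 0, -60, 0, 0, 0, 0, 0, 0, 0, 0, -1],
    [0, 60, 0, 0, 0, 0, 0, 0, 0, 0, 0, 0, 0, 0, 0, -60],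
    [3600, 0, 0, 0, 0, 0, 0, 0, 0, 0, 0, 0, 0, 0, 0, -60, 0, 0, 0, 0, 0, 0, 0, 0, 1],
    [608400, 2400, 0, 0, 0, 0, 0, 0, 0, 0, 0, 0, -6000, 0, 0, 0, 0, 0, 0, 0, 0, 0, 0, 0, 0,
     -100],
    [32400, 0, 0, 0, 0, 0, 0, 0, 0, 0, 0, 0, -240, 0, 0, 0, 0, 0, 0, 0, 0, 0, 0, 0, 0, -4],
    [1040400, -2400, 0, 0, 0, 0, 0, 0, 0, 0, 0, 0, -6000, 0, 0, 0, 0, 0, 0, 0, 0, 0, 0, 0, 0,
     -100],
    [608400, 2400, 0, 0, 0, 0, 0, 0, 0, 0, 0, 0, 0, -6000, 0, 0, 0, 0, 0, 0, 0, 0, 0, 0, 0, 0,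
     -100],
    [32400, 0, 0, 0, 0, 0, 0, 0, 0, 0, 0, 0, 0, -240, 0, 0, 0, 0, 0, 0, 0, 0, 0, 0, 0, 0, -4],
    [1040400, -2400, 0, 0, 0, 0, 0, 0, 0, 0, 0, 0, 0, -6000, 0, 0, 0, 0, 0, 0, 0, 0, 0, 0, 0, 0,
     -100],
    [608400, 2400, 0, 0, 0, 0, 0, 0, 0, 0, 0, 0, 0, 0, -6000, 0, 0, 0, 0, 0, 0, 0, 0, 0, 0, 0,
     0, -100],
    [32400, 0, 0, 0, 0, 0, 0, 0, 0, 0, 0, 0, 0, 0, -240, 0, 0, 0, 0, 0, 0, 0, 0, 0, 0, 0, 0, -4],
    [1040400, -2400, 0, 0, 0, 0, 0, 0, 0, 0, 0, 0, 0, 0, -6000, 0, 0, 0, 0, 0, 0, 0, 0, 0, 0, 0,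
     0, -100]]"

text \<open>This is the negated block inequality, multiplied by 4 * 3600. The fourth entry is
  counted negatively: its linear part enters through \<open>D44\<close>, which is
  \<open>- B44\<close>, and its product with the opposite sign.\<close>

definition level1_goal :: "int \<Rightarrow> int \<Rightarrow> int \<Rightarrow> int \<Rightarrow> int list" where
  "level1_goal w1 w2 w3 w4 =
    [-291600, 0, 0, 0, 0, 0, 0, 0, 0, 0, 0, 0, 240 * w1, 240 * w2, 240 * w3, 240 * w4,
     0, 0, 0, 0, 0, 0, 0, 0, 0, 4 * w1, 4 * w2, 4 * w3, -4 * w4]"

definition level1_cert1 :: cert where
  "level1_cert1 = Split 7 41 (Split 3 (-9) (Split 3 (-35) (Split 4 0 (Split 10 30
 (Leaf [26,187,0,200,0,0,63,0,183,0,131,175,0,114,0,102,0,0,1,0,0,0,0,0,2]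
[0,169,0,0,0,0,0,0,102,0,277])
 (Leaf [290,3462,0,5000,0,0,0,0,3064,0,1490,1986,0,1159,0,1159,0,0,4,0,0,0,0,0,23]
[0,1308,0,0,0,0,-1,0,1159,0,3084])) (Split 4 30
 (Leaf [2,22,0,23,0,0,16,0,2,21,21,0,0,24,0,8] [0,21,16,0,0,0,0,0,8,0,24])
 (Leaf [150,1653,0,2000,0,0,485,0,0,1796,1796,0,0,1083,143,456,0,0,0,0,0,0,0,0,7]
[0,1750,485,0,0,0,0,-71,456,0,1596])))
 (Leaf [1,0,0,0,0,0,0,0,0,12,0,11,0,4,0,4,0,0,0,0,0,0,0,2] [0,0,0,0,0,-5,-6,0,4,12,12]))
 (Split 5 (-13) (Split 6 0
 (Leaf [13,50,0,0,58,0,0,7,60,94,96,58,0,51,0,51,0,0,0,0,0,0,0,0,1] [50,0,0,39,7,0,0,-51,0,156,156])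
 (Leaf [1,3,0,0,5,0,0,1,4,8,0,12,4,0,0,4,0,0,0,0,0,0,0,2] [3,0,0,3,0,-4,-7,0,0,12,12,0,0,-1]))
 (Leaf [2,3,0,0,9,0,0,1,0,24,4,20,1,7,8,0,0,0,0,0,0,0,0,4] [3,0,0,9,1,-8,-17,-6,0,24,24])))
 (Split 8 42 (Split 4 (-17) (Split 1 40 (Split 5 37 (Split 3 0 (Split 6 0
 (Leaf [1,9,0,24,0,0,1,3,0,12,0,12,11,1,1,3] [3,6,1,0,3,0,0,0,3])
 (Leaf [1,9,0,16,0,0,0,0,0,12,1,3,8,4,0,4,0,0,0,0,2] [0,9,0,0,0,0,-3,0,3])) (Split 5 19
 (Split 9 50
 (Leaf [8,32,0,30,14,0,48,0,0,36,13,0,0,96,30,2,0,15,0,0,21] [2,12,48,8,0,0,0,0,0,0,12,0,0,-1])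
 (Leaf [372,0,31,3039,5000,0,2119,0,0,3163,573,0,0,4462,1487,0,13,0,0,39]
[0,920,2119,1203,0,0,0,0,0,562,564,4464,0,-4987])) (Split 3 30 (Split 6 (-28)
 (Leaf [29,37,0,500,131,0,231,107,0,347,0,209,52,295,116,0,0,0,0,0,34]
[37,51,231,0,104,0,0,-92,0,1,57,0,0,0,-107])
 (Leaf [6,0,0,128,21,0,48,14,0,72,0,58,35,37,0,24,0,0,0,0,3] [0,32,48,21,14,-1,-43,-6,0,0,2]))
 (Split 10 22
 (Leaf [19,97,0,300,85,0,199,73,0,227,159,68,0,227,50,25] [59,300,199,85,73,0,-4,-108,0,0,27])
 (Split 6 (-20) (Split 2 35 (Leaf [18,300,251,0,80,0,142,121,0,213,9,97,50,162,71,0,0,0,0,1]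
[83,0,141,80,120,-213,-53,-19,0,0,116,0,0,0,-121])
 (Leaf [8,52,61,67,13,0,65,128,0,94,51,43,0,94,0,31] [52,65,65,0,0,0,0,-83,31,0,96,0,0,0,-128]))
 (Leaf [8,20,31,75,12,0,58,23,0,96,0,27,10,86,0,32,0,0,0,0,17]
[0,75,58,12,23,0,-27,-83,0,0,28,0,0,0,-22])))))) (Split 3 0 (Split 3 (-30)
 (Leaf [1,12,0,12,0,0,0,0,0,0,4,8,8,4,0,4,0,3] [0,12,0,0,0,0,0,0,4,0,0,8])
 (Leaf [221,2500,0,5000,0,0,0,150,0,2350,0,2650,2650,0,0,883,0,75]
[0,5000,0,0,150,0,-834,0,442,0,0,1768])) (Split 10 22 (Split 6 (-26)
 (Leaf [2,24,0,32,0,0,21,7,0,24,17,7,1,23,8] [6,30,21,0,7,-1,0,-23,0,0,2])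
 (Leaf [1,1,0,16,0,0,10,0,0,12,0,12,1,11,0,4] [0,7,10,0,0,-1,-12,-11])) (Split 6 (-19)
 (Split 6 (-34)
 (Leaf [3,54,11,37,0,0,13,64,0,35,35,0,32,4,0,12] [54,34,13,0,0,-31,0,-4,12,0,36,0,0,0,-64])
 (Leaf [1,14,9,7,0,0,4,16,0,12,0,12,10,2,0,4] [13,6,4,0,16,-10,0,-2,4,0,12,0,0,0,-16]))
 (Split 3 30 (Leaf [1,4,0,24,0,0,7,3,0,12,0,12,7,5,0,4] [1,17,6,0,3,-2,-8,-5,0,0,0,1])
 (Leaf [167,689,786,1540,0,0,1333,635,0,2000,0,892,901,1099,0,667,0,0,0,0,50,9]
[154,1540,1333,0,635,-1802,-892,-1099,0,0,904])))))) (Split 5 36 (Split 4 (-39) (Split 10 22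
 (Split 6 (-35) (Leaf [167,1484,1560,0,537,0,1756,1438,0,1398,562,1438,0,2000,667,0,0,0,6]
[381,0,89,0,1438,0,0,0,0,17,1515])
 (Leaf [42,0,181,395,148,0,439,16,0,392,16,484,0,500,0,167,0,0,1] [0,0,314,49,16,0,-288]))
 (Split 6 (-31) (Leaf [25,104,143,105,79,0,263,164,0,209,0,107,0,300,100,0,0,23,0,0,48]
[40,0,14,0,94,0,0,0,0,0,107,1,-100,-1,-163])
 (Leaf [167,0,338,1153,242,0,1756,262,0,1428,0,171,0,2000,0,667,0,143,0,0,457]
[0,0,34,6,262,0,-171,-226,0,0,176,0,-658,0,-262]))) (Split 10 22 (Split 6 (-36)
 (Leaf [1667,12021,10364,0,2845,0,16214,10326,0,6188,13812,6188,0,20000,0,6667,0,0,138]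
[1815,0,16213,0,10326,0,0,0,6134,0,8612,1342])
 (Leaf [167,0,319,970,229,0,1756,229,0,609,608,1247,0,2000,0,667,0,0,14,0,0,1]
[0,0,1289,0,229,0,-604,0,0,3])) (Split 6 (-38)
 (Leaf [12,126,73,23,16,0,105,200,0,43,126,17,0,143,17,30,0,25]
[99,0,105,0,0,0,0,0,30,0,144,0,-14,0,-199]) (Split 5 0
 (Leaf [2,0,1,0,6,0,0,0,0,0,3,0,0,24,2,6,0,6,0,0,5] [0,0,0,0,0,0,0,0,0,0,4,16]) (Split 3 40
 (Leaf [25,0,16,195,48,0,200,40,0,187,47,18,0,300,0,100,0,28,0,0,59]
[0,0,200,6,40,0,0,-72,0,0,64,0,0,0,-40])
 (Leaf [167,266,984,262,376,0,1333,637,0,1000,0,672,0,2000,0,667,0,182,3,0,332]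
[0,0,411,0,637,0,-672,-994,0,0,666,3,0,-20,-637])))))) (Split 3 0
 (Leaf [141,477,0,5000,0,0,1129,419,0,1693,0,1693,896,797,0,564] [0,158,0,0,368,0,0,0,304])
 (Split 3 30 (Split 10 32
 (Leaf [7,5,0,128,27,0,69,21,0,84,0,84,15,69,28] [0,0,69,22,21,0,-42,0,0,0,1]) (Split 6 (-12)
 (Leaf [2,7,13,24,9,0,16,32,0,24,0,24,12,12,8] [7,10,5,8,8,0,0,0,0,0,24,0,0,0,-32])
 (Leaf [122,0,0,2000,46,0,979,139,0,1469,0,606,376,1092,0,490,0,0,0,0,96,5]
[0,42,979,46,139,-1,-606,-528,0,0,153,0,-10,0,-20]))) (Split 4 (-39) (Split 10 20 (Split 3 45
 (Split 2 41 (Leaf [5,62,64,0,22,0,53,44,0,60,0,60,16,44,20] [0,0,23,22,44,0,-60,-3,0,0,47])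
 (Leaf [2,5,7,21,9,0,21,14,0,24,0,24,6,18,7,1] [5,0,15,0,14,0,-17,0,0,0,12])) (Split 5 48
 (Leaf [40,410,500,0,181,0,427,382,0,480,96,384,106,374,16,144]
[0,0,378,180,382,0,-384,-162,1,0,421,0,-1,-1])
 (Leaf [2,21,24,0,9,0,21,21,0,24,3,21,10,14,0,8] [0,0,21,9,21,-15,-21,-6,0,0,24]))) (Split 6 (-35)
 (Split 2 35 (Leaf [9,120,128,0,40,0,94,104,0,105,0,68,64,41,2,33,0,0,0,0,9]
[0,0,25,40,104,-104,-57,-8,0,0,72,0,-26,0,-104])
 (Leaf [2,20,30,1,9,0,20,48,0,23,0,23,15,8,0,8] [18,0,1,0,1,-22,0,-5,1,0,24,0,-8,0,-48]))
 (Split 3 45 (Leaf [167,0,562,1665,752,0,1778,774,0,2000,0,681,1204,796,0,667,0,0,0,0,69,10]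
[0,372,0,752,774,-922,-681,0,0,0,728,0,-658,0,-236])
 (Leaf [1,6,16,0,4,0,10,12,0,12,0,12,6,6,0,4] [0,0,0,3,12,-12,-12,-4,1,0,12,0,-3])))) (Split 10 22
 (Split 3 45 (Leaf [2,4,12,17,9,0,21,12,0,24,6,18,0,24,0,8] [3,2,21,1,12,0,-15,-24,0,0,10])
 (Leaf [83,567,1000,0,203,0,872,551,0,993,94,596,0,993,0,331,0,0,0,0,0,3]
[1,0,869,76,551,-993,-596,-993,28,0,678])) (Split 6 (-36)
 (Leaf [7,99,114,0,0,0,73,128,0,83,30,53,2,81,0,28] [63,0,73,0,26,-75,-53,-62,28,0,84,0,-27,0,-128])
 (Leaf [167,440,1162,1067,0,0,1333,561,0,2000,0,622,0,2000,0,667,0,0,0,0,22,13]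
[130,1067,1333,0,561,-1400,-622,-2000,167,0,616,0,0,0,-561])))))))) (Split 5 0 (Split 5 (-30)
 (Split 9 28 (Split 6 10 (Leaf [105,149,0,13,149,0,0,0,0,28,0,162,1000,262,0,421,0,0,12,0,95,7]
[149,13,0,149,0,0,0,-109,202,0,180,360]) (Split 2 41
 (Leaf [1667,19512,6569,0,19512,0,0,0,3977,13333,0,6667,20000,0,0,6667,0,0,27,0,2801,21]
[19512,0,0,19512,0,0,0,0,0,17304,99,5716])
 (Leaf [150,583,0,0,2000,0,0,468,403,1399,0,699,1802,0,221,380,0,0,0,0,0,11]
[583,0,0,102,0,0,0,0,0,1800,700,515])))
 (Leaf [11,150,55,6,300,0,0,0,110,21,0,17,98,34,27,17,0,0,0,0,29]
[150,6,0,0,0,0,0,0,0,132,16,132,0,-300])) (Split 9 37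
 (Leaf [8,16,17,0,31,0,0,0,0,28,0,14,0,96,18,14,0,17,0,0,20] [16,0,0,31,0,-28,0,-28,0,5,13,45])
 (Leaf [23,89,6,0,178,0,0,0,0,10,30,5,75,200,87,5,0,66,0,0,60]
[89,0,0,178,0,-10,0,-10,0,12,36,276,0,-178]))) (Split 4 0 (Split 3 0
 (Leaf [2,1,0,8,0,0,0,0,0,0,1,7,0,24,0,8,0,6,0,0,4] [0,1,0,0,0,0,-2,0,8]) (Split 3 36
 (Leaf [2,0,2,10,2,0,0,2,0,12,0,4,0,24,0,8,0,3,0,0,5] [0,10,0,0,2,0,-3,-24,4,0,4,0,0,0,-2])
 (Leaf [417,0,2394,0,284,0,0,284,0,2394,846,81,0,5000,0,1667,0,0,26,0,0,41]
[0,0,0,0,284,-2313,-81,-5000,833,0,904,0,0,0,-10])))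
 (Leaf [2,0,0,0,6,0,0,0,0,0,3,0,0,24,2,6,0,6,0,0,5] [0,0,0,6,0,0,0,-18,6,0,4,15,0,-1]))))
 (Split 3 0 (Split 3 (-30) (Split 4 0 (Split 1 35
 (Leaf [1,16,0,24,0,0,0,0,12,0,4,8,0,4,0,4,0,0,0,0,0,0,0,2] [0,8,0,0,0,0,0,0,4])
 (Leaf [7,0,0,96,0,0,96,0,0,0,0,56,0,84,0,28,0,21,0,0,7] [0,0,0,0,0,0,0,0,28,0,0,0,-28]))
 (Split 1 35 (Leaf [1,16,0,24,0,0,0,0,4,8,12,0,0,4,0,4,0,0,0,0,0,0,0,2] [0,8,0,0,0,0,0,0,4])
 (Leaf [8,0,0,300,0,0,20,0,0,93,0,82,0,50,0,31,0,0,0,0,3,0,0,11] [0,0,0,0,0,0,0,-4,31])))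
 (Split 3 (-15) (Split 3 (-23) (Split 4 0
 (Leaf [27,219,0,500,0,0,0,0,213,0,5,281,0,108,0,108,0,28,0,0,9,0,0,54] [0,232,0,0,0,0,0,0,108])
 (Leaf [44,437,0,1000,0,0,27,0,0,530,437,32,0,203,0,177,0,0,0,0,15,0,0,82]
[0,464,26,0,0,0,0,0,177]))
 (Leaf [833,5000,0,20000,0,0,0,0,1333,8667,0,10000,500,2833,500,2833,0,0,0,0,0,0,67]
[0,0,0,0,0,-5000,-2500,0,2833])) (Split 4 0
 (Leaf [4,0,0,96,0,0,0,4,0,48,0,48,0,12,4,12,0,0,0,0,0,0,0,9] [0,0,0,0,2,0,-39,0,12,0,0,0,-4])
 (Leaf [2,0,0,48,3,0,0,0,0,24,0,24,1,7,1,7,0,0,0,0,0,0,0,4] [0,0,0,2,0,-19,0,0,7]))))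
 (Split 4 (-13) (Split 1 34 (Split 5 27 (Split 5 0
 (Leaf [11,28,0,0,49,0,128,5,0,0,20,0,0,128,19,23,1,8,0,0,27] [0,0,0,0,5,0,0,0,0,0,24,0,-40,0,-3])
 (Split 3 30 (Leaf [114,41,0,2000,548,0,1367,96,0,1367,0,633,0,1367,456,0,0,0,0,3,100]
[0,0,951,351,96,0,-441,0,0,0,0,0,-446,0,-96]) (Split 10 30
 (Leaf [23,162,109,300,208,0,261,54,0,273,225,47,0,273,62,29]
[63,299,261,208,54,-1,0,-6,1,0,1,0,-64,0,-2])
 (Leaf [39,15,0,500,357,0,391,3,0,469,58,4,0,469,153,4,0,0,0,4]
[0,301,358,357,3,0,-4,-13,0,1,68,0,-156,-1,-3])))) (Split 3 30 (Split 10 39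
 (Leaf [51,261,0,1000,0,0,555,102,0,606,0,606,303,303,24,178]
[141,182,555,0,102,0,-479,-303,0,0,2,0,-120,0,-1]) (Split 6 0
 (Leaf [5,19,0,96,0,0,46,78,0,58,12,46,38,20,19] [19,36,30,0,11,-49,0,0,0,0,60,0,-17,0,-78])
 (Leaf [2,0,0,48,0,0,4,6,0,24,0,24,4,5,0,8,0,0,0,0,0,0,0,3]
[0,40,4,0,6,-14,-16,-5,0,0,0,0,0,0,-6]))) (Split 4 (-37) (Split 10 30
 (Leaf [14,185,0,247,0,0,500,34,0,165,165,0,37,128,0,55] [0,75,225,0,34,-165,0,-9,0,0,0,0,-44])
 (Leaf [23,274,93,219,0,0,500,57,0,275,72,0,138,138,0,92,0,0,0,0,51]
[16,219,162,0,57,-274,0,-138,0,0,72,0,-92,0,-57]))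
 (Leaf [8,23,0,96,0,0,96,10,0,96,19,0,2,94,3,29,0,0,0,0,19]
[15,95,96,0,10,-76,0,-94,9,0,20,0,-32,0,-9])))) (Split 5 32 (Split 5 18
 (Leaf [83,0,177,199,527,0,1000,58,0,376,166,0,0,1000,67,267,3,83,0,0,208]
[0,0,0,77,58,0,0,0,0,0,164,0,-332,0,-58]) (Split 3 30
 (Leaf [63,0,10,742,213,0,1000,64,0,752,119,19,0,752,0,251,0,0,0,2,101]
[0,0,197,213,64,0,0,0,0,0,152,0,-252,0,-64])
 (Leaf [109,0,859,449,859,0,2000,265,0,1308,0,340,0,1308,0,436,0,0,0,0,242]
[0,32,0,828,265,-382,-340,0,0,0,340,0,-436,0,-265]))) (Split 3 30 (Split 4 (-25)
 (Leaf [12,20,0,164,0,0,300,11,0,143,0,39,0,143,20,27,0,0,0,0,26]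
[0,0,0,0,11,-24,-39,0,0,0,18,0,-48,0,-11])
 (Leaf [400,0,0,5000,347,0,4802,347,0,4802,0,966,0,4802,0,1601,0,0,0,9,742]
[0,1589,3325,0,347,-673,-966,-4802,0,0,741,0,-1600,0,-347])) (Split 4 (-26)
 (Leaf [16,37,11,180,13,0,500,28,0,191,45,0,0,191,0,64,0,0,0,0,37]
[0,0,0,13,28,-191,0,0,0,0,44,0,-64,0,-24]) (Split 10 19
 (Leaf [5,21,64,6,38,0,60,32,0,60,5,55,0,60,0,20] [0,2,60,38,32,0,-55,-42,0,0,28,0,-20])
 (Leaf [417,1019,3633,1779,814,0,4472,1012,0,5000,0,1301,0,5000,0,1667,0,0,0,0,0,37]
[0,1720,4472,813,1012,-4169,-1301,-4703,1,0,1304,0,-1664,0,-1012])))))) (Split 6 0 (Split 4 0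
 (Split 5 41 (Split 10 28 (Split 7 75
 (Leaf [4,7,0,0,20,0,41,15,0,4,34,14,0,48,0,16,0,11] [0,0,31,0,15,0,-3,0,16,1,42]) (Split 6 (-36)
 (Leaf [417,929,2366,0,2205,0,5000,2498,0,404,3991,460,0,5000,0,1667,0,0,46,0,0,5]
[0,0,4286,0,445,0,0,0,1667,0,251,0,-1658])
 (Leaf [4,9,26,0,21,0,48,27,0,4,17,31,0,48,0,16,0,11] [0,0,41,0,27,0,-4,0,0,0,1,0,-16])))
 (Split 2 35 (Leaf [417,1568,1154,0,2211,0,4222,320,0,757,333,517,0,5000,0,1667,20,572,0,41]
[0,0,4222,879,319,0,-517,0,861,0,874,10,-1668,-13,-297])
 (Leaf [1246,0,5442,2096,964,0,12622,20000,0,562,4086,10862,0,14947,0,4982,19,3115]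
[0,0,9674,0,659,0,0,0,4981,0,14952,0,-4977,0,-20000]))) (Split 3 30
 (Leaf [4,0,0,48,0,0,47,0,0,47,0,7,0,47,0,16,0,0,0,0,10] [0,28,47,0,0,-26,-7,-47,1,0,7,0,-15])
 (Leaf [83,0,567,433,188,0,1000,129,0,1000,7,250,0,1000,0,333,0,0,0,0,25,6]
[0,433,999,188,129,-1000,-250,-1000,18,0,286,0,-332]))) (Split 10 22 (Split 4 19 (Split 5 13
 (Split 5 (-24)
 (Leaf [3,15,13,0,29,0,0,0,0,0,32,4,0,32,0,12,0,9,0,0,0,0,0,1] [15,0,0,6,0,0,0,0,0,0,0,27])
 (Leaf [42,51,137,0,193,0,439,0,0,0,347,53,0,500,0,167,0,0,5,0,0,1] [51,0,239,151,0,0,0,0,0,0,26]))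
 (Split 5 41 (Leaf [167,0,459,0,771,0,1756,245,0,0,1324,369,0,2000,0,667,0,0,20,0,0,3]
[0,0,1756,603,245,0,0,0,277,0,444])
 (Leaf [167,0,893,210,0,0,1756,0,0,1102,0,667,0,2000,0,667,0,0,9,0,0,13]
[0,210,1756,0,0,-1102,-543,-2000,277,0,704]))) (Split 6 (-30) (Split 7 75
 (Leaf [466,469,0,0,469,0,116,0,0,211,5000,590,0,815,0,1863,0,0,54,0,0,0,0,0,48]
[469,0,116,469,0,0,0,-815,1863,192,0,16,0,-20]) (Split 2 35 (Split 9 37
 (Leaf [20,300,88,0,22,0,0,0,0,0,215,25,11,40,0,80,0,60,0,0,0,0,0,47] [0,0,0,22,0,0,0,-40,80,0,0,4])
 (Leaf [29,300,148,0,104,0,0,57,0,35,276,70,0,69,0,115,0,78,0,0,0,0,0,69]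
[130,0,0,104,57,0,0,-63,115,36,0,72])) (Split 9 30
 (Leaf [3008,0,10185,0,3400,0,0,6801,0,0,20000,7778,2689,6136,0,12034,0,0,361,0,0,83,0,0,273]
[0,0,0,0,0,0,0,-6077,12034]) (Split 5 11
 (Leaf [22,0,224,0,500,0,0,88,0,262,140,114,0,64,0,87,0,0,0,0,0,0,0,0,2]
[0,0,0,5,84,0,0,-47,87,264,0,62,0,-497])
 (Leaf [250,0,1226,0,1070,0,715,1168,0,499,2000,998,0,1177,0,999,0,0,25,0,0,0,0,0,18]
[0,0,715,595,0,0,0,-1177,999,500,336,194])))))
 (Leaf [417,133,1833,0,235,0,0,0,0,0,0,5000,0,611,0,1667,0,334,37,0,0,0,0,1097]
[133,0,0,184,0,0,0,-611,0,-31,0,7,0,-16]))) (Split 6 (-37) (Split 4 10 (Split 2 25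
 (Leaf [167,985,191,0,790,0,1756,196,0,50,303,82,0,2000,0,667,18,46,0,16]
[985,0,1756,789,196,0,0,-327,667,0,374,10,-668,-10,-183])
 (Leaf [167,0,450,0,790,0,1756,1280,0,50,1009,82,0,2000,0,667,0,362,5,0,227]
[0,0,1756,0,0,0,0,-327,667,0,1096,0,-662,0,-1280])) (Split 2 37 (Split 10 33 (Split 8 76
 (Split 5 0 (Split 9 35 (Leaf [32,200,33,0,200,0,0,0,0,0,89,0,195,189,0,128,0,96,0,0,74]
[200,0,0,200,0,0,0,-79,128,0,88,167])
 (Leaf [16,200,105,0,183,0,0,27,0,0,191,0,25,146,0,64,0,48,0,0,0,0,0,5]
[200,0,0,183,0,0,0,-40,64,0,0,172,0,-183]))
 (Leaf [2,6,12,0,15,0,5,18,0,3,19,5,0,24,0,8,0,5] [6,0,5,10,0,0,0,-24,8,0,24,14])) (Split 4 20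
 (Leaf [35,104,139,0,289,0,500,0,0,0,254,0,0,415,0,138,0,104,0,0,40]
[104,0,500,197,0,0,0,0,138,0,1,0,-140]) (Split 4 27
 (Leaf [25,233,164,0,209,0,259,39,0,0,300,0,0,300,0,100,0,75]
[233,0,259,209,0,0,0,-52,100,0,5,0,-76]) (Split 0 94
 (Leaf [86,723,384,0,156,0,43,919,0,20,1000,33,0,169,0,344,0,253,0,0,0,0,0,216]
[723,0,43,156,0,0,0,-169,344,15,1032,0,-344,-1]) (Split 9 35
 (Leaf [167,1407,733,0,309,0,0,1780,0,0,2000,0,0,419,0,667,0,146,14,0,0,0,0,395]
[1407,0,0,309,0,0,0,-415,667,0,2004,0,-657,-114,-1780])
 (Leaf [41,500,236,0,230,0,0,438,0,95,338,154,0,103,0,164,0,99,0,0,0,0,0,97]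
[500,0,0,230,0,0,0,-102,164,96,492,104,-164,-230,-438]))))))
 (Leaf [889,12453,5871,0,800,0,119,20000,0,0,10674,0,0,2075,0,3558,107,0,0,0,0,0,86]
[12453,0,119,460,0,0,0,-2075,3558,-32,10668,0,-3556,0,-20000])) (Split 9 43 (Split 4 27
 (Leaf [42,0,129,0,273,0,203,443,0,0,353,0,0,500,0,167,0,48,3,0,37]
[0,0,203,0,0,0,0,-200,167,0,356,132,-165,0,-440]) (Split 8 74
 (Leaf [409,0,1425,0,3083,0,0,5000,0,0,3088,799,1898,3005,0,1634,0,0,49,0,0,10]
[0,0,0,0,0,0,0,-2007,1634,0,3908,4048,-1606,-1,-4984])
 (Leaf [1587,0,6356,0,2856,34,0,20000,0,0,17336,0,0,3913,0,6346,0,0,190,0,0,17,0,0,151]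
[0,0,0,0,0,0,0,-3913,6346,0,17344,624,-6335,0,-19990])))
 (Leaf [4,0,31,0,33,0,2,64,0,19,17,31,0,8,0,16,0,7,0,0,0,0,0,10]
[0,0,2,0,0,0,0,-8,16,20,48,0,-16,-29,-64])))) (Split 4 24 (Split 5 12 (Split 9 45 (Split 8 76
 (Leaf [1667,2538,1704,0,11172,0,0,0,0,0,1982,2667,0,20000,0,6667,27,4318,0,154]
[2538,0,0,3977,0,0,0,-6760,0,0,4604,11113]) (Split 5 (-41)
 (Leaf [417,2910,426,0,3486,3139,0,0,0,0,495,667,0,5000,0,1667,37,335,0,0,959]
[2910,0,0,1667,0,0,0,0,0,-36,1168,10,-1668])
 (Leaf [25,46,26,0,209,67,122,0,0,0,30,40,0,300,0,100,0,75,0,2,7]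
[46,0,122,100,0,0,0,0,0,0,72,0,-100]))) (Split 8 76
 (Leaf [346,0,353,0,5000,0,1629,0,0,0,411,553,0,4015,0,1383,41,0,0,32,0,0,1]
[0,0,1629,833,0,0,0,-22,1,52,952,4052,0,-5000])
 (Leaf [292,0,411,0,5000,978,1419,471,0,0,183,937,0,3499,0,1166,35,0,0,24]
[0,0,1419,591,471,0,0,0,0,0,1104,2712,-1168,-4970,-471]))) (Split 8 77 (Split 5 28
 (Leaf [1667,0,4707,0,8578,0,13333,2782,0,2316,0,6522,0,20000,0,6667,122,1365,0,0,3370]
[0,0,13333,8578,2782,-1571,-1073,-418,0,0,6524,0,0,0,-2782])
 (Leaf [167,0,295,0,105,0,1344,80,0,105,0,517,0,2000,0,667,0,373,4,0,371]
[0,0,1344,105,79,0,-171,-2000,0,0,520,0,-13,0,-79])) (Split 5 36 (Split 10 36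
 (Leaf [15,0,200,0,167,0,158,54,0,107,0,175,0,180,0,60,0,18,0,0,1]
[0,0,143,167,54,-11,-97,0,0,0,50,0,-60])
 (Leaf [167,0,512,0,1092,0,1611,586,0,0,0,853,0,2000,0,667,20,0,0,3,204]
[0,0,1611,735,586,0,0,0,0,0,888,0,-668,0,-586]))
 (Leaf [42,0,91,0,36,0,439,35,0,40,0,141,0,500,0,167,0,88,1,0,90]
[0,0,439,36,35,-40,-39,-410,0,0,144,0,-162,0,-32])))) (Split 5 0 (Split 8 59 (Split 5 (-30)
 (Leaf [184,578,155,0,1155,0,0,139,0,0,0,423,2000,212,0,737,0,376,7,0,447]
[578,0,0,1,0,0,0,0,565,1,420,1938,-736])
 (Leaf [761,2235,604,0,4469,0,0,0,0,0,0,1648,4134,5000,0,3045,0,2284,0,49,643]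
[2235,0,0,4469,0,0,0,-885,2328,0,1660,6088,0,-10])) (Split 9 38 (Split 2 35 (Split 10 35
 (Split 7 75
 (Leaf [5,48,0,0,48,0,0,0,34,23,38,19,6,12,0,19,0,0,0,0,0,0,0,10] [48,0,0,48,0,0,0,-12,0,56])
 (Split 8 84 (Split 5 (-31) (Leaf [60,362,156,0,500,0,0,0,0,0,29,238,495,219,0,238,0,179,0,0,112]
[362,0,0,215,0,0,0,-69,0,0,0,489])
 (Leaf [5,9,13,0,16,0,0,0,0,0,3,20,3,24,0,20,0,15,0,0,9,0,0,8] [9,0,0,16,0,0,0,-24,0,0,0,9]))
 (Split 4 36 (Leaf [8,92,48,0,92,42,0,0,26,0,34,19,0,96,0,32,0,17,0,0,11] [92,0,0,92,0,0,0,-20])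
 (Leaf [12,30,29,0,30,7,0,0,0,0,3,48,10,30,0,48,0,36,0,0,23,0,0,26]
[30,0,0,30,0,0,0,-30,0,0,6,0,-45])))) (Split 6 (-19) (Split 5 (-30)
 (Leaf [24,37,25,0,48,0,0,28,0,0,0,43,58,30,0,96,0,72,0,0,61,0,0,50]
[37,0,0,8,0,0,0,-30,96,0,44,0,-96,-1,-28])
 (Leaf [2,2,3,0,4,0,0,0,0,0,0,4,2,6,0,8,0,6,0,0,5,0,0,4] [2,0,0,4,0,0,0,-6,7,0,4,0,-8]))
 (Leaf [1325,7097,9272,0,763,0,0,20000,0,0,0,15896,3767,1113,0,5299,45,2848,0,0,0,0,110]
[7097,0,0,763,20000,0,0,-1113,1783,0,15900,0,-5290,0,-20000]))) (Split 4 42 (Split 8 84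
 (Leaf [3,0,3,0,24,0,0,0,0,0,0,8,12,23,0,12,0,9,0,0,7] [0,0,0,0,0,0,0,-7,1,0,8,21,-4])
 (Leaf [381,0,430,0,5000,2335,0,0,1479,0,108,1066,0,4569,0,1523,0,32,30,0,849]
[0,0,0,0,0,0,0,-939,0,1444,1176,3,-1524,-30])) (Split 10 35 (Split 8 84
 (Leaf [24,0,46,0,200,0,0,52,0,0,0,126,151,134,0,95,0,46,1,0,40] [0,0,0,0,0,0,0,-58,0,0,128,197])
 (Leaf [483,0,733,0,862,0,0,511,0,0,0,2000,400,718,0,1932,0,1268,7,0,949,0,0,1169]
[0,0,0,0,0,0,0,-718,767,0,2000,0,-1931]))
 (Leaf [1,0,7,0,3,1,0,16,0,0,0,12,3,1,0,4,0,3,0,0,0,0,0,2] [0,0,0,0,0,0,0,0,4,0,12,0,-4,-1,-16]))))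
 (Split 5 (-24) (Leaf [136,2000,1176,0,5000,694,0,0,1628,0,0,394,1174,454,0,543,0,0,0,12]
[2000,0,0,0,0,0,0,0,248,1632,432,1619,-315,-5000]) (Split 2 24
 (Leaf [8140,40000,23908,0,100000,0,0,0,0,20770,0,29329,0,44368,0,32559,769,0,0,683,0,0,533]
[40000,0,0,100000,0,0,0,-41896,5383,20780,29380,44370,-7020,-100000])
 (Leaf [543,0,4793,0,20000,2438,0,0,3559,2955,0,1821,0,6514,0,2171,0,0,0,47]
[0,0,0,0,0,0,0,-2448,583,6514,1816,6516,-764,-19991]))))) (Split 8 76
 (Leaf [83,0,85,0,400,0,0,0,0,0,99,133,0,1000,0,333,0,250,0,5,57]
[0,0,0,400,0,0,0,-1000,333,0,268,498]) (Split 2 37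
 (Leaf [417,0,621,0,3560,4205,184,0,0,195,0,1162,0,5000,0,1667,0,410,32,0,959]
[0,0,184,3560,0,0,-316,-5000,1368,0,1158,10,-1668,-16]) (Split 5 30 (Split 0 89
 (Leaf [417,0,2138,0,3759,4389,0,4656,0,318,0,4963,0,5000,0,1667,47]
[0,0,0,0,3045,0,-258,-5000,1667,0,5004,0,-1658])
 (Leaf [167,0,733,0,1394,1561,194,1880,0,0,0,2000,0,2000,0,667,0,368,5]
[0,0,194,0,1131,0,0,-1901,433,0,2004,0,-664,0,-1869]))
 (Leaf [25,0,51,0,120,113,150,102,0,0,0,140,0,300,0,100,0,75,0,0,40]
[0,0,150,120,97,0,0,-300,100,0,140,0,-100,0,-91]))))))))) (Split 3 32 (Split 10 30
 (Leaf [2,1,0,12,2,0,0,0,0,0,0,24,3,1,0,8,0,6,0,0,0,0,0,5] [1,12,0,1,0,0,-12,0,1]) (Split 5 5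
 (Split 9 42 (Split 7 75
 (Leaf [167,0,0,0,1743,0,0,53,0,2000,0,1047,952,0,118,548,0,0,0,5,111,0,0,262]
[0,0,0,183,0,-1120,-1,0,0,2004,1060]) (Split 2 29
 (Leaf [417,4358,4263,4237,4358,0,0,1774,1051,3949,0,5000,2381,0,440,1227,0,0,0,0,0,0,26]
[4358,4237,0,4358,1774,0,-1092])
 (Leaf [366,0,2461,5000,3825,0,0,1557,0,4389,0,4389,1773,317,0,1463,0,0,0,0,0,0,0,575]
[0,4700,0,1509,242,0,0,-24]))) (Split 5 (-17)
 (Leaf [143,1417,2726,0,5000,334,0,0,0,1719,0,1523,1296,0,313,260,0,0,0,2,0,0,4]
[1417,0,0,0,0,0,-1036,0,0,1716,0,1316,0,-5000])
 (Leaf [735,0,10445,3553,20000,0,0,0,0,8825,0,7821,0,4202,1304,1638,0,0,0,10,0,0,46]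
[0,3553,0,4545,0,-691,-4750,-955,0,8800,0,4220,0,-20000]))) (Split 4 12 (Split 10 49
 (Leaf [1,0,2,7,1,0,9,1,0,0,0,12,0,12,0,4,0,3] [0,3,9,1,1,0,-8,-3,0,0,2])
 (Leaf [4,0,0,11,0,0,35,0,0,0,0,12,0,48,0,16,0,12,0,0,9] [0,5,25,0,0,0,-6,-23,0,0,3,0,-16]))
 (Split 7 75 (Split 6 30 (Leaf [167,0,0,1077,254,0,0,709,0,925,0,2000,0,667,0,667,11,0,0,0,0,0,13]
[0,1077,0,254,709,-925,0,-516,387,829,2004])
 (Leaf [1,0,0,7,2,0,0,0,0,12,0,12,0,4,2,2,0,0,0,0,0,0,0,2] [0,7,0,2,0,-12,-12,-2,2])) (Split 6 30
 (Split 4 36 (Leaf [1,0,5,7,1,0,0,4,0,0,0,12,0,4,0,4,0,3,0,0,0,0,0,2] [0,6,0,1,4,0,0,-4])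
 (Leaf [79,0,347,1000,976,629,0,0,0,890,0,457,0,943,0,314,0,13,0,0,122]
[0,1000,0,976,0,-129,-1,-932,177])) (Split 5 33
 (Leaf [9,0,65,128,72,0,0,0,0,84,0,109,0,36,7,29,0,6,0,0,0,0,0,18] [0,128,0,72,0,0,-55,-11])
 (Leaf [17,0,0,128,0,0,8,0,0,0,0,128,0,76,0,68,0,51,0,0,19,0,0,32] [0,128,8,0,0,0,0,-76])))))))
 (Split 7 75
 (Leaf [8,0,0,0,6,0,0,23,0,0,0,96,29,3,0,32,0,24,0,0,0,0,0,16] [0,0,0,3,23,0,-96,0,3,0,61])
 (Split 6 30 (Split 10 50 (Split 5 0 (Split 9 33 (Split 2 42
 (Leaf [167,462,1720,0,462,0,0,709,0,104,0,2000,742,268,0,667,0,0,19,0,0,0,0,0,10]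
[462,0,0,462,709,-104,-1792,0,0,9,0,0,0,-3])
 (Leaf [167,0,1486,0,544,0,0,777,0,154,0,2000,595,415,0,667,0,0,18,0,0,0,0,0,10]
[0,0,0,388,0,-154,-1691,0,0,204,218]))
 (Leaf [4,10,40,0,37,0,0,17,0,0,0,48,5,19,0,16,0,12,0,0,0,0,0,6]
[10,0,0,15,7,0,-48,0,0,0,0,24,0,-37])) (Split 4 16
 (Leaf [167,0,1667,587,852,0,1444,709,0,587,0,2000,0,2000,0,667,0,213,6]
[0,587,1444,852,709,0,-2000,-556])
 (Leaf [417,0,4167,0,535,0,0,1330,0,0,0,5000,0,1389,0,1667,0,576,27,0,0,0,0,0,36]
[0,0,0,535,1330,0,-5000,-1164,450]))) (Split 5 0 (Split 9 30
 (Leaf [3,0,37,0,17,0,0,48,0,15,0,36,11,9,0,12,0,5,0,0,0,0,0,4]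
[0,0,0,17,14,-15,-7,0,0,0,36,0,-12,0,-48]) (Split 5 (-26)
 (Leaf [29,0,332,0,500,22,0,460,0,92,0,344,234,0,0,115,1,35,0,0,0,0,0,27]
[0,0,0,0,26,0,-264,0,0,108,348,230,-106,-500,-460])
 (Leaf [1,0,12,0,12,0,0,7,0,0,0,12,0,8,0,4,0,3,0,0,0,0,0,1] [0,0,0,7,1,0,-12,0,0,0,0,8,0,-12,-7])))
 (Split 5 33 (Leaf [238,0,5000,235,2331,0,0,1907,0,2856,0,2856,0,951,0,952,0,0,0,0,0,0,0,0,19]
[0,235,0,2331,1907,-2856,-2385,-118,917,0,2856])
 (Leaf [417,0,4178,741,0,0,185,3333,0,752,0,5000,0,1852,0,1667,0,1062,0,0,0,0,0,259,21]
[0,741,185,0,3333,-751,-4346,-1852,1667,0,5004])))) (Split 5 0 (Split 9 30 (Split 5 (-41)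
 (Leaf [417,3615,4999,0,5000,0,0,1773,0,3716,0,4999,3333,0,737,930,0,0,13,0,0,0,0,0,17]
[3615,0,0,3427,1773,0,-4920,0,0,3704,0,0,0,-30])
 (Leaf [72,374,1000,0,773,0,0,307,0,634,0,866,143,435,134,155,0,0,2,0,0,0,0,0,3]
[374,0,0,773,306,-634,-866,0,0,384,3])) (Split 5 (-30)
 (Leaf [1,10,15,0,24,0,0,4,0,7,0,11,8,0,4,0,0,1,0,0,0,0,0,1] [10,0,0,0,4,-5,-11,0,0,8,0,8,0,-22])
 (Leaf [10,33,186,0,300,0,0,42,0,120,0,120,0,80,40,0,0,0,0,0,0,0,0,10]
[33,0,0,108,42,-120,-120,0,0,108,0,80,0,-298]))) (Split 5 28
 (Leaf [1304,0,20000,4892,13829,0,0,0,0,15653,0,9783,0,6096,0,5218,0,0,0,0,0,59,0,0,96]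
[0,4892,0,13829,0,-15652,-9783,-506,0,545,0,871,0,-30])
 (Leaf [667,0,2875,2828,0,0,0,0,0,703,0,5000,0,2667,0,2667,0,1361,19,0,750,0,0,0,53]
[0,2828,0,0,0,-703,-5000,-2500]))))))))))"

definition level1_cert2 :: cert where
  "level1_cert2 = Split 4 0 (Split 4 (-30) (Split 1 35
 (Leaf [12,200,0,0,0,0,141,41,0,0,41,0,141,0,59,82,0,12,0,0,25] [72,0,141,0,41,0,0,0,0,0,44,0,-141])
 (Split 6 (-36) (Leaf [25,174,0,100,0,0,300,102,0,100,34,68,100,200,221,79,0,0,0,0,0,2]
[0,0,249,0,101,0,-3,0,0,0,100,0,-300,0,-3])
 (Leaf [17,42,0,58,0,0,200,41,0,58,0,41,123,77,0,200,0,2,0,0,14,1]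
[0,0,0,0,41,0,-41,-40,0,0,48,0,-200])))
 (Leaf [25,141,0,9,0,0,300,26,0,9,10,7,132,168,0,300,0,23,0,0,71]
[0,0,300,0,26,0,-7,-18,66,0,16,0,-300,0,-26])) (Split 8 55 (Split 5 0
 (Leaf [417,2523,0,0,2523,0,0,0,0,0,0,0,2477,2523,5000,0,0,0,17,0,147,44]
[2523,0,0,2523,0,0,0,0,0,-16,0,5004,-5004,-10])
 (Leaf [42,0,0,0,173,0,0,0,0,0,80,0,0,500,327,173,0,0,2,0,0,4]
[0,0,0,173,0,0,0,-327,173,-32,104,345,-345]))
 (Leaf [417,0,0,0,0,0,0,0,0,0,2523,0,0,0,5000,0,0,0,17,0,0,25,0,0,50]
[0,0,0,0,0,0,0,0,0,-32,2504,0,-5004]))"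

definition level1_cert3 :: cert where
  "level1_cert3 = Split 6 (-6) (Split 4 (-35) (Split 1 42
 (Leaf [327,5000,0,0,0,0,3919,1600,0,0,1306,0,3919,0,1176,2744,0,577,16]
[1323,0,3919,0,1600,0,0,0,0,0,1308,0,-3921,0,-843])
 (Leaf [167,952,0,775,0,0,2000,667,0,775,0,667,672,1328,1438,562,0,0,12]
[1,0,1343,0,667,0,-184,0,97,0,668,0,-2003])) (Split 8 43
 (Leaf [167,0,251,0,0,0,0,0,0,251,416,251,157,1533,0,2000,0,0,17,0,0,0,0,0,3]
[0,0,0,0,0,0,-251,-1127,1421,0,668,0,-310])
 (Leaf [42,0,0,55,0,0,95,0,0,55,121,45,0,95,0,500,0,35,3,0,0,0,0,101]
[0,0,95,0,0,0,-45,-95,344,0,168,0,-504]))) (Split 8 23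
 (Leaf [211,535,0,0,535,0,0,0,0,0,0,0,2000,535,1346,1189,0,0,25,0,0,8]
[535,0,0,535,0,0,0,0,594,32,0,2532,-2532]) (Split 3 (-35)
 (Leaf [52,393,0,423,0,0,30,0,207,216,0,207,0,126,500,121,0,0,2,0,0,0,0,0,5]
[0,423,0,0,0,0,0,0,121,0,208,0,-530])
 (Leaf [1701,352,0,563,88,0,0,0,0,563,0,4636,0,416,20000,416,0,0,199,0,0,22,0,0,200]
[29,563,0,88,0,-563,-3191,0,416,0,4604,3,-20006])))"

text \<open>The weight 1 can sit at the negatively counted entry, at the entry diagonally opposite
  to it, or at one of the two entries adjacent to it. Transposition exchanges the adjacent ones, so
  three certificates serve four patterns.\<close>

lemma level1_checks:
  "check level1_products (level1_goal 3 3 3 1 # level1_constraints) level1_box level1_cert1"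
  "check level1_products (level1_goal 1 3 3 3 # level1_constraints) level1_box level1_cert2"
  "check level1_products (level1_goal 3 1 3 3 # level1_constraints) level1_box level1_cert3"
  by code_simp+

text \<open>The variables \<open>q3\<close>, \<open>q4\<close> stand for the column entries divided
  by r, so the entries of the second complement are \<open>B + x * q\<close> and no division enters
  the system. \<open>D44\<close> is the negative of the fourth entry after one step.\<close>

lemma level1_core:
  fixes r u v b3 b4 a3 a4 x3 x4 q3 q4 B33 B34 B43 D44 :: real and w1 w2 w3 w4 :: int
  assumes ok: "check level1_products (level1_goal w1 w2 w3 w4 # level1_constraints) level1_box t"
    and r: "71/60 \<le> r" "r \<le> 109/60"
    and uv: "0 \<le> u" "u \<le> 1" "0 \<le> v" "v \<le> 1" "r \<le> 1 + u * v"
    and ba: "\<bar>b3\<bar> \<le> 1" "\<bar>b4\<bar> \<le> 1" "\<bar>a3\<bar> \<le> 1" "\<bar>a4\<bar> \<le> 1"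
    and x: "0 \<le> x3" "x3 \<le> r" "x3 \<le> 1 + u * b3" "0 \<le> x4" "x4 \<le> r" "x4 \<le> 1 + u * b4"
    and q: "0 \<le> q3" "q3 \<le> 1" "r * q3 \<le> 1 + v * a3" "0 \<le> q4" "q4 \<le> 1" "r * q4 \<le> 1 + v * a4"
    and B: "\<bar>B33\<bar> \<le> r" "B33 \<le> 1 - a3 * b3" "\<bar>B34\<bar> \<le> r" "B34 \<le> 1 - a4 * b3"
           "\<bar>B43\<bar> \<le> r" "B43 \<le> 1 - a3 * b4" "\<bar>D44\<bar> \<le> r" "D44 \<le> 1 + a4 * b4"
    and N: "B33 + x3 * q3 \<le> 3 * r - r\<^sup>2" "B34 + x3 * q4 \<le> 3 * r - r\<^sup>2" "B43 + x4 * q3 \<le> 3 * r - r\<^sup>2"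
  shows "w1 * (B33 + x3 * q3) + w2 * (B34 + x3 * q4) + w3 * (B43 + x4 * q3) + w4 * (D44 - x4 * q4)
    \<le> 81/4"
proof (rule ccontr)
  assume neg: "\<not> ?thesis"
  let ?xs = "map ((*) 60) [r, u, v, b3, b4, a3, a4, x3, x4, q3, q4, B33, B34, B43, D44]"
  \<comment> \<open>Since u and v are at most 1, each of them is at least u v, hence at least r -
    1.\<close>
  have "u * v \<le> u * 1" "u * v \<le> 1 * v"
    using uv by (intro mult_left_mono mult_right_mono; simp)+
  then have uv': "11/60 \<le> u" "11/60 \<le> v" using r uv by linarith+
  have "in_box level1_box ?xs"
    using r uv uv' ba x q B by (simp add: in_box_def level1_box_def abs_le_iff)
  moreover have "\<forall>(i, j)\<in>set level1_products. i < length ?xs \<and> j < length ?xs"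
    by (simp add: level1_products_def)
  moreover have "0 \<le> quad_eval level1_products (level1_goal w1 w2 w3 w4) ?xs"
    using neg by (simp add: quad_eval_def products_def level1_products_def level1_goal_def algebra_simps)
  moreover have "\<forall>c\<in>set level1_constraints. 0 \<le> quad_eval level1_products c ?xs"
  proof -
    \<comment> \<open>Tangents at 13/10, 3/2 and 17/10. They replace the square of r, which is not
      among the products.\<close>
    have "3 * r - r\<^sup>2 \<le> 2/5 * r + 169/100" "3 * r - r\<^sup>2 \<le> 9/4" "3 * r - r\<^sup>2 \<le> 289/100 - 2/5 * r"
      using zero_le_power2[of "r - 13/10"] zero_le_power2[of "r - 3/2"] zero_le_power2[of "r - 17/10"]
      by (simp_all add: power2_eq_square algebra_simps)
    then show ?thesis
      using r uv x q B N
      by (simp add: quad_eval_def products_def level1_products_def level1_constraints_def algebra_simps abs_le_iff)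
  qed
  ultimately show False using check_sound[OF ok, of ?xs] by simp
qed

section \<open>The second Schur complement\<close>

text \<open>
  After scaling the first pivot to 1, let \<open>r\<close> be the absolute value of the second one. With signs
  suitably normalised, the second pivot row and column contribute \<open>r \<le> 1 + u * v\<close>; every later row
  \<open>i\<close> is described by its first entry and by its entry \<open>x\<close> after one step (predicate \<open>row_ok\<close>), and
  dually every later column. An entry \<open>B\<close> of the first Schur complement then becomes \<open>B + x * y / r\<close>.
\<close>

definition row_ok :: "real \<Rightarrow> real \<Rightarrow> real \<Rightarrow> real \<Rightarrow> bool" where
  "row_ok r u b x \<longleftrightarrow> \<bar>b\<bar> \<le> 1 \<and> \<bar>x\<bar> \<le> r \<and> \<bar>x - u * b\<bar> \<le> 1"

text \<open>\<open>B + a * b\<close> is the entry before the first step, bounded by the first pivot,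
  and \<open>B\<close> the entry after it, bounded by the second. In \<open>row_ok\<close> the entry
  before the step is likewise \<open>x - u * b\<close>.\<close>

definition entry_ok :: "real \<Rightarrow> real \<Rightarrow> real \<Rightarrow> real \<Rightarrow> bool" where
  "entry_ok r b a B \<longleftrightarrow> \<bar>B\<bar> \<le> r \<and> \<bar>B + a * b\<bar> \<le> 1"

text \<open>\<open>r - u * v\<close> is, up to sign, the second diagonal entry before the first
  step, hence at most the first pivot 1.\<close>

definition pivot_ok :: "real \<Rightarrow> real \<Rightarrow> real \<Rightarrow> bool" where
  "pivot_ok r u v \<longleftrightarrow> 0 \<le> u \<and> u \<le> 1 \<and> 0 \<le> v \<and> v \<le> 1 \<and> r \<le> 1 + u * v"

section \<open>Symmetries: sign changes and transposition\<close>

lemma sign_mult: "s \<in> {1, -1} \<Longrightarrow> t \<in> {1, -1} \<Longrightarrow> s * t \<in> {1, -1 :: real}"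
  by auto

lemma sign_minus: "s \<in> {1, -1} \<Longrightarrow> - s \<in> {1, -1 :: real}"
  by auto

lemma row_ok_sign: "\<sigma> \<in> {1, -1} \<Longrightarrow> row_ok r u b x \<Longrightarrow> row_ok r u (\<sigma> * b) (\<sigma> * x)"
  by (auto simp: row_ok_def abs_le_iff)

lemma entry_ok_sign:
  "\<sigma> \<in> {1, -1} \<Longrightarrow> \<tau> \<in> {1, -1} \<Longrightarrow> entry_ok r b a B \<Longrightarrow> entry_ok r (\<sigma> * b) (\<tau> * a) (\<sigma> * \<tau> * B)"
  by (auto simp: entry_ok_def abs_le_iff)

lemma pivot_ok_swap: "pivot_ok r u v \<Longrightarrow> pivot_ok r v u"
  by (auto simp: pivot_ok_def mult.commute)

lemma entry_ok_swap: "entry_ok r b a B \<Longrightarrow> entry_ok r a b B"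
  by (auto simp: entry_ok_def mult.commute)

text \<open>From u \<ge> r - 1 follows x \<le> 1 - (r - 1) \<bar>b\<bar>, while B is at most both r
  and 1 + \<bar>b\<bar>. The resulting bound on the sum increases in \<bar>b\<bar> up to
  \<bar>b\<bar> = r - 1 and decreases afterwards; at the peak it equals 3 r - r^2. The variable
  \<open>z\<close> stands for x y / r.\<close>

lemma entry_le_opposite_signs:
  fixes r u v a b x B z :: real
  assumes r: "1 \<le> r" "r \<le> 2" and p: "pivot_ok r u v" and b: "b \<le> 0" "\<bar>b\<bar> \<le> 1" and a: "\<bar>a\<bar> \<le> 1"
    and x: "x \<le> 1 + u * b" and B: "B \<le> r" "B \<le> 1 - a * b" and z: "z \<le> x"
  shows "B + z \<le> 3 * r - r\<^sup>2"
proof -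
  have "u * v \<le> u * 1" using p by (intro mult_left_mono) (auto simp: pivot_ok_def)
  then have "r - 1 \<le> u" using p by (simp add: pivot_ok_def)
  then have "u * b \<le> (r - 1) * b" using b by (intro mult_right_mono_neg)
  then have x': "x \<le> 1 - (r - 1) * (- b)" using x by simp
  have "(- a) * b \<le> 1 * (- b)"
    using a b by (metis abs_le_iff minus_le_iff mult_minus_left mult_minus_right mult_right_mono neg_0_le_iff_le)
  then have B': "B \<le> 1 + (- b)" using B by simp
  show ?thesis
  proof (cases "- b \<le> r - 1")
    case True
    then have "(2 - r) * (- b) \<le> (2 - r) * (r - 1)" using r by (intro mult_left_mono) auto
    then show ?thesis using x' B' z by (simp add: power2_eq_square algebra_simps)
  next
    case False
    then have "(r - 1) * (r - 1) \<le> (r - 1) * (- b)" using r by (intro mult_left_mono) auto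
    then show ?thesis using x' B z by (simp add: power2_eq_square algebra_simps)
  qed
qed

text \<open>Since x and y are at most r, the product term x y / r is below both. If b and a have
  opposite signs, the previous estimate applies to the row or, transposed, to the column. If both
  are negative, or if x or y is at most 1, the sum is at most 2. What remains is b, a \<ge> 0 with
  x, y > 1.\<close>

lemma entry_le_nonneg:
  assumes r: "1 \<le> r" "r \<le> 2" and p: "pivot_ok r u v" and row: "row_ok r u b x" and col: "row_ok r v a y"
    and B: "entry_ok r b a B" and pos: "0 \<le> x" "0 \<le> y"
  shows "B + x * y / r \<le> 3 * r - r\<^sup>2"
proof -
  have x: "x \<le> r" "x \<le> 1 + u * b" "\<bar>b\<bar> \<le> 1" using row by (auto simp: row_ok_def)
  have y: "y \<le> r" "y \<le> 1 + v * a" "\<bar>a\<bar> \<le> 1" using col by (auto simp: row_ok_def)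
  have B1: "B \<le> r" "B \<le> 1 - a * b" using B by (auto simp: entry_ok_def)
  have zx: "x * y / r \<le> x" and zy: "x * y / r \<le> y"
    using mult_left_mono[OF y(1) pos(1)] mult_right_mono[OF x(1) pos(2)] r
    by (simp_all add: divide_le_eq mult.commute)
  have "0 \<le> (r - 1) * (2 - r)" using r by (intro mult_nonneg_nonneg) auto
  then have two: "2 \<le> 3 * r - r\<^sup>2" by (simp add: power2_eq_square algebra_simps)
  have uv: "0 \<le> u" "u \<le> 1" "0 \<le> v" "v \<le> 1" using p by (auto simp: pivot_ok_def)
  consider "b \<le> 0" "0 \<le> a" | "0 \<le> b" "a \<le> 0" | "b \<le> 0" "a \<le> 0" | "0 \<le> b" "0 \<le> a" by linarith
  then show ?thesis
  proof cases
    case 1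
    then show ?thesis using entry_le_opposite_signs[OF r p _ x(3) y(3) x(2) B1 zx] by simp
  next
    case 2
    then show ?thesis
      using entry_le_opposite_signs[OF r pivot_ok_swap[OF p] _ y(3) x(3) y(2) B1(1) _ zy] B1
      by (simp add: mult.commute)
  next
    case 3
    then have "u * b \<le> 0" "0 \<le> a * b" using uv by (auto simp: mult_nonneg_nonpos mult_nonpos_nonpos)
    then show ?thesis using x B1 zx two by linarith
  next
    case 4
    then have ab: "0 \<le> a * b" by simp
    show ?thesis
    proof (cases "x \<le> 1 \<or> y \<le> 1")
      case True
      then show ?thesis using ab B1 zx zy two by linarith
    next
      case False
      have "u * b \<le> 1 * b" "v * a \<le> 1 * a"
        using 4 uv by (intro mult_right_mono; simp)+
      then have "(y - 1) * (x - 1) \<le> a * b"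
        using False 4 x y by (intro mult_mono) linarith+
      \<comment> \<open>With B \<le> 1 - (x - 1) (y - 1), the bound is bilinear in x and y and
        reaches 3 r - r^2 at x = y = r. The expression here is the gap to that corner value, written
        with nonnegative factors.\<close>
      moreover have "0 \<le> (r - x) * (1 - y * (r - 1) / r) + (r - y) * (2 - r)"
      proof (intro add_nonneg_nonneg mult_nonneg_nonneg)
        have "y * (r - 1) \<le> r * 1" using y r pos by (intro mult_mono) auto
        then show "0 \<le> 1 - y * (r - 1) / r" using r by (simp add: divide_le_eq)
      qed (use x y r in auto)
      moreover have "(r - x) * (1 - y * (r - 1) / r) + (r - y) * (2 - r)
          = 3 * r - r\<^sup>2 - (1 - (y - 1) * (x - 1) + x * y / r)"
        using r by (simp add: field_simps power2_eq_square)
      ultimately show ?thesis using B1 by linarith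
    qed
  qed
qed

text \<open>Negating row and column together preserves the entry, which reduces equal signs of x and
  y to the nonnegative case; for opposite signs the product term only helps. Negating the row alone
  turns the upper bound into the lower one.\<close>

lemma entry_bound:
  assumes r: "1 \<le> r" "r \<le> 2" and p: "pivot_ok r u v" and row: "row_ok r u b x" and col: "row_ok r v a y"
    and B: "entry_ok r b a B"
  shows "\<bar>B + x * y / r\<bar> \<le> 3 * r - r\<^sup>2"
proof -
  have "0 \<le> r * (2 - r)" using r by (intro mult_nonneg_nonneg) auto
  then have r': "r \<le> 3 * r - r\<^sup>2" by (simp add: power2_eq_square algebra_simps)
  have upper: "B + x * y / r \<le> 3 * r - r\<^sup>2"
    if "row_ok r u b x" "row_ok r v a y" "entry_ok r b a B" for b x a y B
  proof (cases "0 \<le> x \<longleftrightarrow> 0 \<le> y")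
    case True
    then consider "0 \<le> x" "0 \<le> y" | "0 \<le> - x" "0 \<le> - y" by linarith
    then show ?thesis
    proof cases
      case 1 then show ?thesis using entry_le_nonneg[OF r p that] by simp
    next
      case 2
      moreover have "row_ok r u (- b) (- x)" "row_ok r v (- a) (- y)" "entry_ok r (- b) (- a) B"
        using row_ok_sign[of "-1" r u b x] row_ok_sign[of "-1" r v a y]
          entry_ok_sign[of "-1" "-1" r b a B] that by auto
      ultimately show ?thesis using entry_le_nonneg[OF r p, of "- b" "- x" "- a" "- y" B] by simp
    qed
  next
    case False
    then have "x * y / r \<le> 0" using r
      by (intro divide_nonpos_nonneg) (auto simp: mult_le_0_iff)
    then show ?thesis using that(3) r' by (auto simp: entry_ok_def)
  qed
  have "row_ok r u (- b) (- x)" "entry_ok r (- b) a (- B)"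
    using row_ok_sign[of "-1" r u b x] entry_ok_sign[of "-1" 1 r b a B] row B by auto
  then show ?thesis
    using upper[OF row col B] upper[of "- b" "- x" a y "- B"] col by (auto simp: abs_le_iff)
qed

text \<open>With x, y \<ge> 0 the product terms are nonnegative, so the entry counted negatively
  works against them. The local fact \<open>core\<close> is stated for fresh variables so that it
  can also be used with rows and columns exchanged.\<close>

lemma block_one_bad:
  fixes w1 w2 w3 w4 :: int
  assumes w: "(w1, w2, w3, w4) \<in> {(3, 3, 3, 1), (1, 3, 3, 3), (3, 1, 3, 3), (3, 3, 1, 3)}"
    and r: "71/60 \<le> r" "r \<le> 109/60" and p: "pivot_ok r u v"
    and rows: "row_ok r u b x" "row_ok r u b' x'" and cols: "row_ok r v a y" "row_ok r v a' y'"
    and B: "entry_ok r b a B1" "entry_ok r b a' B2" "entry_ok r b' a B3" "entry_ok r b' a' B4"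
    and pos: "0 \<le> x" "0 \<le> x'" "0 \<le> y" "0 \<le> y'"
  shows "w1 * (B1 + x * y / r) + w2 * (B2 + x * y' / r) + w3 * (B3 + x' * y / r)
    - w4 * (B4 + x' * y' / r) \<le> 81/4"
proof -
  have core: "w1 * (B1 + x * y / r) + w2 * (B2 + x * y' / r) + w3 * (B3 + x' * y / r)
      - w4 * (B4 + x' * y' / r) \<le> 81/4"
    if "check level1_products (level1_goal w1 w2 w3 w4 # level1_constraints) level1_box t"
      and p: "pivot_ok r u v"
      and rows: "row_ok r u b x" "row_ok r u b' x'" and cols: "row_ok r v a y" "row_ok r v a' y'"
      and B: "entry_ok r b a B1" "entry_ok r b a' B2" "entry_ok r b' a B3" "entry_ok r b' a' B4"
      and pos: "0 \<le> x" "0 \<le> x'" "0 \<le> y" "0 \<le> y'"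
    for w1 w2 w3 w4 :: int and t u v b x b' x' a y a' y' B1 B2 B3 B4
  proof -
    have r': "1 \<le> r" "r \<le> 2" using r by auto
    note N = entry_bound[OF r' p rows(1) cols(1) B(1)] entry_bound[OF r' p rows(1) cols(2) B(2)]
      entry_bound[OF r' p rows(2) cols(1) B(3)]
    have "w1 * (B1 + x * (y / r)) + w2 * (B2 + x * (y' / r)) + w3 * (B3 + x' * (y / r))
        + w4 * (- B4 - x' * (y' / r)) \<le> 81/4"
      by (rule level1_core[OF that(1) r, of u v b b' a a'])
        (use p rows cols B pos r N in \<open>auto simp: pivot_ok_def row_ok_def entry_ok_def abs_le_iff divide_le_eq\<close>)
    then show ?thesis by (simp add: algebra_simps)
  qed
  consider "(w1, w2, w3, w4) = (3, 3, 3, 1)" | "(w1, w2, w3, w4) = (1, 3, 3, 3)"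
    | "(w1, w2, w3, w4) = (3, 1, 3, 3)" | "(w1, w2, w3, w4) = (3, 3, 1, 3)" using w by auto
  then show ?thesis
  proof cases
    case 1 then show ?thesis using core[OF level1_checks(1) p rows cols B pos] by simp
  next
    case 2 then show ?thesis using core[OF level1_checks(2) p rows cols B pos] by simp
  next
    case 3 then show ?thesis using core[OF level1_checks(3) p rows cols B pos] by simp
  next
    case 4
    \<comment> \<open>Transposing the block exchanges \<open>B2\<close> with \<open>B3\<close> and
      thereby moves the weight 1 to \<open>B3\<close>.\<close>
    have "3 * (B1 + y * x / r) + 1 * (B3 + y * x' / r) + 3 * (B2 + y' * x / r) - 3 * (B4 + y' * x' / r) \<le> 81/4"
      using core[OF level1_checks(3) pivot_ok_swap[OF p] cols rows entry_ok_swap[OF B(1)] entry_ok_swap[OF B(3)]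
          entry_ok_swap[OF B(2)] entry_ok_swap[OF B(4)] pos(3,4,1,2)] by simp
    then show ?thesis using 4 by (simp add: algebra_simps)
  qed
qed

text \<open>The four coefficients have a negative product of signs, so one or three of them are
  negative. A single negative one is moved to the last place by permuting rows and columns, which
  shifts the weight 1. Three negative ones are excluded by size, because N \<ge> B \<ge> -
  r.\<close>

lemma block_nonneg:
  assumes r: "71/60 \<le> r" "r \<le> 109/60" and p: "pivot_ok r u v"
    and rows: "row_ok r u b x" "row_ok r u b' x'" and cols: "row_ok r v a y" "row_ok r v a' y'"
    and B: "entry_ok r b a B1" "entry_ok r b a' B2" "entry_ok r b' a B3" "entry_ok r b' a' B4"
    and pos: "0 \<le> x" "0 \<le> x'" "0 \<le> y" "0 \<le> y'"
    and signs: "e \<in> {1, -1}" "e' \<in> {1, -1}" "f \<in> {1, -1}" "f' \<in> {1, -1::real}"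
  shows "3 * (e * f * (B1 + x * y / r)) + 3 * (e * f' * (B2 + x * y' / r))
    + 3 * (e' * f * (B3 + x' * y / r)) - e' * f' * (B4 + x' * y' / r) \<le> 81/4"
proof -
  have r': "1 \<le> r" "r \<le> 2" using r by auto
  define N1 N2 N3 N4 where N: "N1 = B1 + x * y / r" "N2 = B2 + x * y' / r" "N3 = B3 + x' * y / r"
    "N4 = B4 + x' * y' / r"
  have up: "N1 \<le> 3 * r - r\<^sup>2" "N2 \<le> 3 * r - r\<^sup>2" "N3 \<le> 3 * r - r\<^sup>2" "N4 \<le> 3 * r - r\<^sup>2"
    using entry_bound[OF r' p rows(1) cols(1) B(1)] entry_bound[OF r' p rows(1) cols(2) B(2)]
      entry_bound[OF r' p rows(2) cols(1) B(3)] entry_bound[OF r' p rows(2) cols(2) B(4)]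
    by (auto simp: N abs_le_iff)
  have "0 \<le> x * y / r" "0 \<le> x * y' / r" "0 \<le> x' * y / r" "0 \<le> x' * y' / r"
    using pos r' by auto
  then have low: "- N1 \<le> r" "- N2 \<le> r" "- N3 \<le> r" "- N4 \<le> r"
    using B by (auto simp: N entry_ok_def abs_le_iff)
  \<comment> \<open>These are 3 (3 r - r^2) + 7 r and (3 r - r^2) + 9 r, the worst values with three
    negative signs. Both increase on the range of r, so the tangent at its right end
    suffices.\<close>
  have sq: "16 * r - 3 * r\<^sup>2 \<le> 81/4" "12 * r - r\<^sup>2 \<le> 81/4"
    using r zero_le_power2[of "r - 109/60"] by (auto simp: power2_eq_square algebra_simps)
  have "3 * N1 + 3 * N2 + 3 * N3 - 1 * N4 \<le> 81/4"
    using block_one_bad[OF _ r p rows cols B pos, of 3 3 3 1] by (simp add: N)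
  moreover have "3 * N1 + 3 * N2 + 1 * N4 - 3 * N3 \<le> 81/4"
    using block_one_bad[OF _ r p rows cols(2,1) B(2,1,4,3) pos(1,2,4,3), of 3 3 1 3] by (simp add: N)
  moreover have "3 * N1 + 1 * N4 + 3 * N3 - 3 * N2 \<le> 81/4"
    using block_one_bad[OF _ r p rows(2,1) cols B(3,4,1,2) pos(2,1,3,4), of 3 1 3 3] by (simp add: N)
  moreover have "1 * N4 + 3 * N2 + 3 * N3 - 3 * N1 \<le> 81/4"
    using block_one_bad[OF _ r p rows(2,1) cols(2,1) B(4,3,2,1) pos(2,1,4,3), of 1 3 3 3] by (simp add: N)
  moreover have "3 * N1 - 3 * N2 - 3 * N3 - N4 \<le> 81/4" "3 * N2 - 3 * N1 - 3 * N3 - N4 \<le> 81/4"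
      "3 * N3 - 3 * N1 - 3 * N2 - N4 \<le> 81/4" "N4 - 3 * N1 - 3 * N2 - 3 * N3 \<le> 81/4"
    using up low sq by linarith+
  ultimately have "3 * (e * f * N1) + 3 * (e * f' * N2) + 3 * (e' * f * N3) - e' * f' * N4 \<le> 81/4"
    using signs by auto
  then show ?thesis by (simp add: N)
qed

text \<open>For a block of negative product the signs can be chosen so that the first three terms
  become absolute values; the last coefficient then also has the sign of its entry. Quantifying over
  all signs gives a family of linear constraints in which no case distinction on the entries is
  left.\<close>

theorem block_bound:
  assumes r: "71/60 \<le> r" "r \<le> 109/60" and p: "pivot_ok r u v"
    and rows: "row_ok r u b x" "row_ok r u b' x'" and cols: "row_ok r v a y" "row_ok r v a' y'"
    and B: "entry_ok r b a B1" "entry_ok r b a' B2" "entry_ok r b' a B3" "entry_ok r b' a' B4"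
    and signs: "e \<in> {1, -1}" "e' \<in> {1, -1}" "f \<in> {1, -1}" "f' \<in> {1, -1::real}"
  shows "3 * (e * f * (B1 + x * y / r)) + 3 * (e * f' * (B2 + x * y' / r))
    + 3 * (e' * f * (B3 + x' * y / r)) - e' * f' * (B4 + x' * y' / r) \<le> 81/4"
proof -
  define \<sigma> where "\<sigma> z = (if z < 0 then -1 else 1 :: real)" for z :: real
  have \<sigma>: "\<sigma> z \<in> {1, -1}" "0 \<le> \<sigma> z * z" "\<sigma> z * \<sigma> z = 1" for z by (auto simp: \<sigma>_def)
  \<comment> \<open>The signs that make x, x', y, y' nonnegative are absorbed into e, e', f,
    f'.\<close>
  have key: "s * \<sigma> z * (t * \<sigma> z') * (\<sigma> z * \<sigma> z' * D + \<sigma> z * z * (\<sigma> z' * z') / r) = s * t * (D + z * z' / r)"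
    for s t z z' D
    by (auto simp: \<sigma>_def)
  show ?thesis
    using block_nonneg[OF r p row_ok_sign[OF \<sigma>(1) rows(1)] row_ok_sign[OF \<sigma>(1) rows(2)]
        row_ok_sign[OF \<sigma>(1) cols(1)] row_ok_sign[OF \<sigma>(1) cols(2)]
        entry_ok_sign[OF \<sigma>(1) \<sigma>(1) B(1)] entry_ok_sign[OF \<sigma>(1) \<sigma>(1) B(2)]
        entry_ok_sign[OF \<sigma>(1) \<sigma>(1) B(3)] entry_ok_sign[OF \<sigma>(1) \<sigma>(1) B(4)]
        \<sigma>(2)[of x] \<sigma>(2)[of x'] \<sigma>(2)[of y] \<sigma>(2)[of y'],
        of "e * \<sigma> x" "e' * \<sigma> x'" "f * \<sigma> y" "f' * \<sigma> y'"]
      sign_mult[OF signs(1) \<sigma>(1)] sign_mult[OF signs(2) \<sigma>(1)] sign_mult[OF signs(3) \<sigma>(1)]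
      sign_mult[OF signs(4) \<sigma>(1)]
    by (simp only: key)
qed

section \<open>Certificates for the last two steps\<close>

text \<open>
  The variables, all scaled by 90, are \<open>s, u, v, m, \<epsilon>, \<phi>, n, k, o, R, p, q, z, c\<close>. The third Schur
  complement divided by its pivot is the matrix with rows \<open>(1, u, -\<epsilon>)\<close>, \<open>(v, -m, n)\<close>, \<open>(-\<phi>, k, o)\<close>;
  \<open>s\<close> is the first pivot divided by the third, \<open>R = m + u v\<close>, \<open>p = n + v \<epsilon> = z R\<close> and
  \<open>q = k + u \<phi> = c R\<close>, so that the fifth pivot divided by the third is \<open>o - \<epsilon> \<phi> + z q\<close>.
\<close>

definition level3_products :: "(nat \<times> nat) list" where
  "level3_products =
    [(1, 2), (2, 4), (1, 5), (4, 5), (12, 9), (13, 9), (12, 11), (13, 10)]"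

definition level3_box :: "(int \<times> int) list" where
  "level3_box =
    [(40, 42), (0, 90), (0, 90), (0, 90), (-90, 90), (-90, 90), (-90, 90), (-90, 90), (-90,
    90), (90, 180), (0, 180), (0, 180), (0, 90), (0, 90)]"

text \<open>The quantity p q / R occurs both as z q and as c p. Keeping both forms adds nothing
  exactly, but each form has its own McCormick relaxation. The rows after these two are nineteen
  instances of the block inequality.\<close>

definition level3_constraints :: "int list list" where
  "level3_constraints =
   [[0, 0, 0, 0, 90, 0, 0, 0, 0, 0, -90, 0, 0, 0, 0, 1],
    [0, 0, 0, 0, 0, 0, 0, 90, 0, 0, 0, -90, 0, 0, 0, 0, 1],
    [0, 0, 0, 0, 0, 0, 0, 0, 90, 0, 0, 0, -90, 0, 0, 0, 0, 1],
    [0, 0, 0, 0, 0, 0, 0, 0, 0, 0, 0, 90, 0, 0, 0, 0, 0, 0, 0, -1],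
    [0, 0, 0, 0, 0, 0, 0, 0, 0, 0, 0, -90, 0, 0, 0, 0, 0, 0, 0, 1],
    [0, 0, 0, 0, 0, 0, 0, 0, 0, 0, 0, 0, 90, 0, 0, 0, 0, 0, 0, 0, -1],
    [0, 0, 0, 0, 0, 0, 0, 0, 0, 0, 0, 0, -90, 0, 0, 0, 0, 0, 0, 0, 1],
    [0, 0, 0, 0, 0, 0, 0, 0, 0, -90, 90, 0, 0, 0, 0, 0, 0, 0, 1],
    [0, -10890, 0, 0, 0, 0, 0, 0, 0, 2250, 0, 0, 0, 0, 0, 0, 0, 0, -25, 0, 0, 25],
    [0, -10890, 0, 0, 0, 0, 0, 0, 0, 2250, 0, 0, 0, 0, 0, 0, 0, 0, -25, 0, 0, 0, 25],
    [-97200, 7290, -360, -1080, -1080],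
    [-97200, 7290, -1080, -360, -1080],
    [-97200, 7290, -1080, -1080, -360],
    [-97200, 7290, 0, -1080, 0, -360, 0, -1080],
    [-97200, 7290, 0, -360, 0, -1080, 0, -1080],
    [-97200, 7290, 0, -1080, 0, -1080, 0, -360],
    [0, 7290, -1080, 0, -1080, 360, 0, -1080],
    [-97200, 7290, -1080, 0, 0, 0, -360, 0, -1080],
    [-97200, 7290, -1080, 0, 0, 0, -1080, 0, -360],
    [-97200, 7290, 0, 0, 0, 360, -1080, 0, 0, -1080],
    [-97200, 7290, 0, 0, 0, -1080, 360, 0, 0, -1080],
    [0, 7290, -360, 0, 0, -1080, 0, 0, -1080, -1080],
    [0, 7290, -1080, 0, 0, -360, 0, 0, -1080, -1080],
    [0, 7290, 0, -1080, -1080, 0, 360, 0, -1080],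
    [0, 7290, 0, -360, 0, 0, -1080, -1080, 0, -1080],
    [0, 7290, 0, -1080, 0, 0, -360, -1080, 0, -1080],
    [0, 7290, 0, 0, -360, 0, 0, -1080, -1080, -1080],
    [0, 7290, 0, 0, -1080, 0, 0, -360, -1080, -1080],
    [0, 7290, 0, 0, -1080, 0, 0, -1080, -360, -1080]]"

definition level3_cert :: cert where
  "level3_cert = Split 4 0 (Split 13 45 (Leaf [12,12,0,0,0,0,0,12,0,1] [12,12,0,0,0,0,0,25]) (Split 12 45
 (Split 12 23
 (Leaf [64,53,16,0,0,0,0,64,3,2,0,1,0,0,0,0,0,0,0,0,0,0,0,0,0,0,0,0,4] [64,53,1,0,0,0,75,50])
 (Split 13 56
 (Leaf [48,48,12,0,0,0,0,48,1,3,0,0,0,0,0,0,1,0,0,0,0,0,0,0,0,0,0,0,3] [48,48,0,0,0,0,25,75])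
 (Split 13 64 (Leaf [500,458,125,0,0,0,24,483,12,26,0,10,0,0,0,0,0,0,0,0,0,0,0,0,0,0,0,0,31]
[500,458,0,0,0,24,300,650]) (Split 2 45
 (Leaf [20000,0,0,0,0,0,6667,13333,533,0,0,714] [2857,0,0,4,0,6667,13325]) (Split 4 (-65)
 (Leaf [144,200,6,0,0,0,0,144,1,8,0,0,0,0,0,0,7,0,0,4,0,0,0,0,0,0,0,0,2] [144,0,0,0,0,0,25,200])
 (Split 5 0 (Leaf [0,0,8,0,0,0,0,0,1] [0,0,0,0,0,0,25]) (Split 13 77
 (Leaf [929,1000,155,0,0,0,158,794,25,47,0,39,0,0,0,0,0,0,0,0,0,0,0,0,13,0,0,0,39]
[929,1000,152,-6,0,158,625,1175]) (Split 4 (-41)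
 (Leaf [228,500,40,0,0,0,0,228,3,20,0,0,0,0,0,0,9,0,0,16,0,0,0,0,0,0,0,0,10]
[228,0,40,0,0,0,75,500])
 (Leaf [237,300,39,0,0,0,237,0,22,12,0,10,0,0,0,0,0,0,0,8,0,0,0,0,15,0,0,0,10]
[234,296,39,-520,0,237,550,300]))))))))) (Split 12 68 (Split 13 68 (Split 2 45
 (Leaf [96,96,17,0,0,0,0,96,1,5,0,0,0,0,0,0,1,0,0,0,0,0,0,0,0,0,0,0,4] [96,96,0,0,0,0,25,125])
 (Leaf [0,200,0,90,0,0,0,45,0,6] [0,0,0,0,-90,0,0,150])) (Split 2 45 (Split 5 0
 (Leaf [0,0,12,0,0,0,0,0,1] [0,0,0,0,0,0,25]) (Split 1 45
 (Leaf [200,100,17,0,0,0,55,145,4,4,0,0,0,0,0,0,0,0,0,0,0,0,0,0,0,0,0,0,4]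
[200,100,17,0,0,55,100,100]) (Split 2 23
 (Leaf [20000,9838,1738,0,0,0,5254,14746,370,394,0,41,0,0,0,0,458,0,72,0,0,0,0,0,0,0,0,0,362]
[0,9838,0,0,0,5254,9250,9850]) (Split 13 77
 (Leaf [42,64,8,0,0,8,0,48,0,3,0,1,0,0,0,0,0,0,0,0,0,0,0,0,0,0,0,0,2] [42,38,0,0,0,-8,0,71])
 (Split 4 (-54) (Leaf [200,200,0,0,0,0,0,200,0,8,0,0,0,0,0,0,8] [40,0,0,0,0,0,0,200]) (Split 5 45
 (Leaf [29,48,10,0,0,0,7,22,1,2,0,0,0,0,0,0,0,0,0,0,0,0,0,0,0,0,0,0,2] [29,48,10,0,0,7,25,50])
 (Split 13 83 (Leaf [1106,2000,227,0,0,227,0,1300,0,87,0,35,0,0,0,0,0,0,0,0,0,0,0,0,16,0,0,0,57]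
[1106,1497,167,0,0,-227,0,2062]) (Split 12 57 (Split 4 (-27) (Split 1 68
 (Leaf [397,500,83,0,0,0,6,391,6,20,0,0,0,0,0,0,0,0,0,0,0,0,0,0,0,0,0,0,21]
[397,500,0,0,0,6,150,500]) (Split 13 86
 (Leaf [1209,2000,225,0,0,13,0,1221,13,84,0,21,0,0,0,0,23,0,0,44,0,0,0,0,0,0,0,0,56]
[1209,1744,0,0,0,-12,325,2093]) (Split 2 34
 (Leaf [13029,20000,2083,0,0,0,354,12675,154,800,0,0,0,0,0,0,494,0,0,410,0,0,0,0,0,0,0,0,521]
[8819,20000,0,0,0,354,3850,20000]) (Split 4 (-37)
 (Leaf [2379,5000,370,0,0,337,0,2700,2,200,0,81,0,0,0,0,25,0,0,104,0,0,0,0,0,0,0,0,92]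
[2379,0,0,0,0,-337,50,4832]) (Split 13 88
 (Leaf [571,1000,90,0,0,43,0,612,3,41,0,25,0,0,0,0,0,0,0,0,0,0,0,0,18,0,0,0,23]
[571,899,10,0,0,-43,75,994]) (Split 12 51
 (Leaf [112,200,77,0,0,0,112,0,13,8,0,0,0,0,0,0,0,0,10,5,0,0,0,0,7,0,0,0,9]
[106,200,0,-465,0,112,325,200]) (Split 5 68
 (Leaf [82,200,27,0,0,0,0,82,2,8,0,0,0,0,0,0,0,0,0,0,0,0,0,0,0,0,0,0,7] [82,200,27,0,0,0,50,200])
 (Split 5 79 (Leaf [588,1000,100,0,0,0,0,588,6,40,0,25,0,0,0,0,0,0,1,0,0,0,0,0,19,0,0,0,24]
[575,970,0,0,0,0,150,1000])
 (Leaf [8945,20000,1435,0,0,1403,0,10317,2,801,0,387,0,0,0,0,0,0,0,174,0,0,0,0,280,0,0,0,359]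
[8945,2512,1435,-9758,0,-1402,50,19323])))))))))
 (Leaf [95,200,48,0,0,0,95,0,9,8,0,0,0,0,0,0,0,0,4,2,0,0,0,0,9,0,0,0,8]
[95,200,48,-425,0,95,225,200])) (Split 4 (-40) (Split 1 77
 (Leaf [10390,20000,914,2885,0,0,0,12217,58,685,0,0,0,0,0,0,259,0,0,300,0,0,0,0,0,0,0,0,228]
[10390,0,914,0,-2885,0,0,17125])
 (Leaf [10390,20000,914,2885,0,0,0,12217,58,685,0,0,0,0,0,0,580,0,0,300,0,0,0,0,0,0,0,0,228]
[0,0,0,0,-2885,0,0,17125])) (Split 4 (-20) (Split 13 86
 (Leaf [229,500,49,0,0,49,0,274,0,21,0,7,0,0,0,0,0,0,0,7,0,0,0,0,1,0,0,0,12]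
[228,385,39,0,0,-49,0,491]) (Split 12 63 (Split 1 68
 (Leaf [118,200,33,0,0,13,0,130,1,8,0,0,0,0,0,0,0,0,0,0,0,0,0,0,0,0,0,0,8]
[118,200,33,0,0,-13,25,194]) (Split 2 29
 (Leaf [3282,5000,505,0,0,0,0,3282,29,200,0,0,0,0,0,0,130,0,0,77,0,0,0,0,0,0,0,0,126]
[0,5000,0,0,0,0,725,5000]) (Split 5 68
 (Leaf [133,300,44,0,0,13,0,146,2,12,0,0,0,0,0,0,0,0,0,0,0,0,0,0,0,0,0,0,11]
[133,300,44,0,0,0,50,293]) (Split 13 88
 (Leaf [503,1000,88,0,0,88,0,587,0,41,0,20,0,0,0,0,0,0,0,0,0,0,0,0,14,0,0,0,22]
[503,651,41,0,0,-88,0,981]) (Split 4 (-30) (Split 13 89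
 (Leaf [759,2000,467,0,0,467,0,1216,0,81,0,0,0,0,0,0,0,0,54,4,0,0,0,0,0,0,0,0,63]
[749,813,284,-20,0,-466,0,1791]) (Split 1 84
 (Leaf [7840,20000,4664,0,0,4664,0,12452,0,801,0,0,0,0,0,0,22,0,535,0,0,0,0,0,0,0,0,0,631]
[7840,5856,2074,0,0,-4664,0,17693]) (Split 5 81
 (Leaf [391,1000,208,0,0,208,0,597,0,40,0,3,0,0,0,0,0,0,23,0,0,0,0,0,4,0,0,0,29]
[391,236,0,0,0,-208,0,896]) (Split 2 36
 (Leaf [421,1000,172,0,0,172,0,590,0,40,0,6,0,0,0,0,3,0,17,8,0,0,0,0,0,0,0,0,26]
[408,563,0,0,0,-172,0,914])
 (Leaf [8371,20000,2982,814,0,2724,0,11581,16,768,0,227,0,0,0,0,0,0,275,0,0,0,0,0,199,0,0,0,470]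
[8371,0,2982,-276,-814,-2724,0,17838])))))
 (Leaf [997,2000,224,0,0,0,0,997,13,80,0,34,0,0,0,0,0,0,7,0,0,0,0,0,49,0,0,0,49]
[997,2000,224,-1328,0,0,325,2000])))))) (Split 13 88
 (Leaf [5881,20000,1114,6416,0,0,0,10372,64,556,0,212,0,0,0,0,0,0,0,0,0,0,0,0,147,0,0,0,278]
[5881,3,144,0,-6416,0,0,13900]) (Split 2 34 (Split 1 68
 (Leaf [106,200,24,0,0,24,0,129,0,8,0,0,0,0,0,0,0,0,0,0,0,0,0,0,0,0,0,0,6]
[106,161,24,0,0,-24,0,188]) (Split 4 (-34)
 (Leaf [1889,5000,307,999,0,0,0,2588,18,160,0,0,0,0,0,0,66,0,0,78,0,0,0,0,0,0,0,0,77]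
[1888,0,0,-10,-999,0,0,4000]) (Split 5 68
 (Leaf [48,128,16,0,0,16,0,64,0,5,0,0,0,0,0,0,0,0,0,0,0,0,0,0,0,0,0,0,4] [48,118,16,0,0,-16,0,117])
 (Split 13 89 (Leaf [756,2000,441,95,0,408,0,1221,2,77,0,0,0,0,0,0,0,0,47,0,0,0,0,0,0,0,0,0,63]
[756,2000,272,0,-95,-408,0,1721]) (Split 5 79
 (Leaf [144,300,28,0,0,28,0,171,0,12,0,5,0,0,0,0,0,0,0,0,0,0,0,0,3,0,0,0,7]
[144,297,0,0,0,-28,0,286])
 (Leaf [1889,5000,1131,0,0,1131,0,3007,0,200,0,0,0,0,0,0,0,0,125,9,0,0,0,0,0,0,0,0,157]
[1889,5000,904,-571,0,-1131,0,4435]))))))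
 (Leaf [6373,20000,1133,4523,0,0,0,9540,65,619,0,248,0,0,0,0,0,0,0,0,0,0,0,0,234,0,0,0,283]
[6373,3,1123,0,-4523,0,0,15475])))))
 (Leaf [104,300,52,0,0,0,104,0,8,12,0,0,0,0,0,0,0,0,4,0,0,0,0,0,9,0,0,0,9]
[104,300,52,-500,0,104,200,300]))))))))))) (Split 5 0 (Leaf [0,0,12,0,0,0,0,0,1] [0,0,0,0,0,0,25])
 (Split 1 45 (Leaf [159,300,53,0,0,13,0,169,2,12,0,0,0,0,0,0,0,0,0,0,0,0,0,0,2,0,0,0,13]
[159,71,53,0,0,-12,50,293]) (Split 4 (-45)
 (Leaf [2105,5000,263,1053,0,0,0,2632,21,158,0,110,0,0,0,0,0,0,0,88,0,0,0,0,0,0,0,0,66]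
[2105,0,0,0,-1053,0,0,3950]) (Split 5 45 (Leaf [0,24,0,0,0,0,0,0,0,1] [0,0,0,0,0,0,0,25])
 (Split 5 68 (Leaf [131,1000,17,70,0,0,0,165,1,37,0,7,0,0,0,0,0,0,0,0,0,0,0,0,0,0,0,0,4]
[121,196,0,0,-70,0,0,925])
 (Leaf [3894,20000,518,2074,0,0,0,4930,41,717,0,195,0,0,0,0,0,0,0,0,0,0,0,0,628,0,0,0,130]
[3888,1195,518,-14020,-2074,0,0,17925])))))))) (Split 13 68
 (Leaf [0,200,0,127,0,0,0,96,0,4] [0,0,0,0,-127,0,0,100]) (Split 2 45 (Split 5 0
 (Leaf [8,24,24,0,0,0,0,0,1,1,0,0,0,0,0,0,0,0,0,0,0,0,0,0,0,0,2] [0,0,4,0,0,0,25,25])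
 (Split 4 (-45) (Leaf [500,1000,0,285,0,0,0,715,0,29] [500,0,0,0,-285,0,0,725]) (Split 5 45
 (Leaf [75,200,25,0,0,0,0,75,1,8,0,0,0,0,0,0,0,0,0,0,0,0,0,0,0,0,0,0,6] [75,150,0,0,0,0,25,200])
 (Split 1 45
 (Leaf [150,200,25,0,0,0,0,150,1,8,0,0,0,0,0,0,0,0,0,0,0,0,0,0,0,0,0,0,6] [150,150,0,0,0,0,25,200])
 (Split 13 79
 (Leaf [97,200,28,0,0,28,0,118,0,9,0,0,0,0,0,0,1,0,0,2,0,0,0,0,0,0,0,0,7] [97,192,28,0,0,-28,0,211])
 (Split 12 79 (Split 1 62
 (Leaf [1401,2000,322,0,0,0,0,1401,15,80,0,0,0,0,0,0,0,0,0,0,0,0,0,0,0,0,0,0,80]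
[1401,1931,322,0,0,0,375,2000]) (Split 4 (-31)
 (Leaf [69,200,0,75,0,0,0,125,0,5] [69,0,0,0,-75,0,0,125]) (Split 13 84
 (Leaf [201,500,57,36,0,44,0,267,1,20,0,2,0,0,0,0,0,0,0,0,0,0,0,0,5,0,0,0,14]
[201,500,57,-10,-26,-44,0,478]) (Split 2 16
 (Leaf [136,200,14,0,0,14,0,149,0,8,0,0,0,0,0,0,3,0,0,1,0,0,0,0,0,0,0,0,3] [0,200,7,0,0,-14,0,193])
 (Split 4 (-16) (Split 2 29
 (Leaf [7676,20000,1578,4177,0,0,0,10832,84,633,0,242,0,0,0,0,3,0,0,195,0,0,0,0,0,0,0,0,394]
[7676,18916,0,0,-4176,0,0,15825])
 (Leaf [1237,5000,240,1406,0,0,0,2300,13,144,0,43,0,0,0,0,0,0,0,0,0,0,0,0,44,0,0,0,60]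
[1237,1,240,0,-1406,0,0,3600]))
 (Leaf [222,1000,52,0,0,0,0,222,2,40,0,5,0,0,0,0,0,0,0,0,0,0,0,0,17,0,0,0,13]
[222,748,52,-828,0,0,50,1000]))))))
 (Leaf [0,20000,0,10651,0,0,0,9349,0,374] [0,0,0,0,-10651,0,0,9350])))))))
 (Leaf [0,500,0,142,0,0,0,108,0,14] [0,0,0,0,-142,0,0,350])))))) (Split 12 20
 (Leaf [5,0,5,0,0,0,0,5,1] [0,0,5,-13,0,0,25]) (Split 12 34
 (Leaf [40,0,48,0,0,0,0,40,5] [0,0,44,-42,0,0,125]) (Split 13 18
 (Leaf [200,45,52,0,0,0,0,200,2,9,11,0,0,0,0,0,0,0,0,0,0,0,0,0,0,0,0,3,3]
[109,22,49,-26,0,0,50,225]) (Split 12 62 (Split 5 0 (Split 5 (-45)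
 (Leaf [156,0,200,0,0,0,0,156,12,0,0,0,0,0,0,0,0,0,0,0,6] [0,0,112,0,0,0,300])
 (Leaf [8,0,16,0,0,0,0,8,1] [0,0,16,0,0,0,25]))
 (Leaf [82,273,300,0,0,0,82,0,22,11,0,0,0,0,0,0,0,5,0,0,0,0,0,0,0,2,20]
[24,273,300,-553,0,82,550,275])) (Split 5 0 (Split 12 76 (Split 2 43
 (Leaf [386,51,500,51,0,0,0,421,24,0,0,0,0,0,0,0,0,0,0,0,0,2,0,0,0,0,0,13] [0,51,177,0,-51,0,565])
 (Split 13 34
 (Leaf [96,24,84,0,5,0,0,92,4,3,2,0,0,0,0,0,0,0,0,0,0,1,0,0,0,0,0,6] [0,1,84,0,5,0,100,75])
 (Split 1 67 (Split 1 37
 (Leaf [379,52,500,52,0,0,0,415,24,0,0,0,0,0,0,0,0,0,0,0,2,0,0,4,0,0,0,13] [0,0,379,0,-52,0,574])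
 (Leaf [1144,168,2000,168,0,0,0,1260,95,0,53,0,0,0,0,0,0,0,0,0,0,7,0,0,0,0,0,42]
[0,3,904,0,-168,0,2291]))
 (Leaf [80,7,300,0,0,36,0,94,12,1,5,0,0,0,0,0,0,0,0,0,0,0,5,0,0,0,0,2] [0,7,0,-13,0,-26,300]))))
 (Split 1 45 (Split 13 41 (Leaf [500,0,0,0,156,0,0,344,0,14,18] [429,0,0,0,156,0,0,350])
 (Split 13 66 (Split 2 45
 (Leaf [200,17,100,0,54,0,0,146,4,4,0,0,0,0,0,0,0,0,0,0,0,0,0,0,0,0,0,4] [0,17,100,0,54,0,100,100])
 (Split 1 23 (Leaf [5000,434,2459,0,1284,0,0,3716,98,94,10,0,0,0,0,18,0,0,0,0,0,0,0,114,0,0,0,91]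
[5000,0,2459,0,1284,0,2450,2350]) (Split 4 45
 (Leaf [96,32,96,0,22,0,0,74,4,3,0,0,0,0,0,0,0,0,0,0,0,0,0,0,0,0,0,8] [0,0,96,0,22,0,100,75])
 (Split 5 (-54) (Leaf [200,0,200,0,0,0,0,200,8,0,0,0,0,0,0,0,0,0,0,0,0,0,0,8] [160,0,0,0,0,0,200])
 (Split 12 82
 (Leaf [366,70,500,13,0,0,0,377,22,3,13,0,0,0,0,0,0,0,0,0,0,3,0,0,0,0,0,17] [0,12,500,0,0,0,534,75])
 (Split 13 54 (Split 5 (-27) (Split 12 85
 (Leaf [600,123,1000,0,6,0,0,594,42,9,0,0,0,0,0,0,0,0,0,0,26,0,0,19,0,0,0,31]
[0,94,1000,0,6,0,1050,225]) (Split 2 68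
 (Leaf [397,83,500,0,3,0,0,394,20,6,0,0,0,0,0,0,0,0,0,0,0,0,0,0,0,0,0,21] [0,0,500,0,3,0,500,150])
 (Split 1 34 (Leaf [500,55,180,0,121,0,0,379,7,12,7,0,0,0,0,6,0,0,0,0,0,0,0,7,0,0,0,8]
[500,7,180,0,121,0,175,300]) (Split 5 (-40)
 (Leaf [449,70,1000,70,0,0,0,515,40,0,1,0,0,0,0,0,0,0,0,0,22,0,0,19,0,0,0,17] [3,0,0,0,-70,0,965])
 (Leaf [2911,453,5000,50,0,0,0,2958,200,27,129,0,0,0,0,0,0,0,0,0,54,43,0,0,0,0,0,113]
[4,11,4997,-10,-50,0,4975,675])))))
 (Leaf [46,23,96,0,46,0,0,0,4,5,0,0,0,0,0,2,0,0,0,0,1,4,0,0,0,0,0,4] [0,11,96,-225,46,0,100,125]))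
 (Split 13 60 (Split 5 (-27) (Split 2 68
 (Leaf [152,32,200,0,0,0,0,152,8,2,0,0,0,0,0,0,0,0,0,0,0,0,0,0,0,0,0,8] [0,0,183,0,0,0,200,50])
 (Split 12 85
 (Leaf [245,46,500,46,0,0,0,286,21,0,4,0,0,0,0,0,0,0,0,0,9,0,0,5,0,0,0,11] [10,6,255,0,-46,0,502])
 (Split 12 87 (Leaf [2381,443,5000,443,0,0,0,2800,207,0,44,0,0,0,0,0,0,0,0,0,87,0,0,44,0,0,0,111]
[0,0,2350,0,-443,0,4954]) (Split 13 57 (Split 1 34
 (Leaf [13029,2083,20000,0,354,0,0,12675,800,154,0,0,0,0,0,0,0,0,0,0,410,0,0,494,0,0,0,521]
[4210,0,20000,0,354,0,20000,3850]) (Split 5 (-34) (Leaf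
[47113,7329,100000,6706,0,2074,0,54841,3922,41,2094,0,0,0,0,0,0,0,0,0,1614,240,0,0,0,0,0,1832]
[0,0,0,0,-6683,-2074,94680])
 (Leaf [999,178,2000,0,0,0,0,999,80,11,39,0,0,0,0,0,0,0,0,0,0,53,0,0,0,0,0,44]
[4,178,384,-948,0,0,2000,275]))) (Split 12 89 (Split 1 34
 (Leaf [1251,200,2000,0,0,0,0,1251,81,12,0,0,0,0,0,0,0,0,0,0,39,0,0,50,0,0,0,50]
[612,0,1672,0,0,0,2025,300])
 (Leaf [2155,346,5000,90,0,809,0,2755,170,16,93,0,0,0,0,0,0,0,0,0,0,71,0,0,0,0,0,87]
[0,79,0,-10,-90,-809,4205])) (Split 5 (-41)
 (Leaf [519,61,1000,61,0,0,0,580,40,0,0,0,0,0,0,0,0,0,0,0,20,0,0,21,0,0,0,15]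
[259,10,1,-1,-61,0,970]) (Split 1 30
 (Leaf [316,48,500,0,0,0,0,316,20,3,0,0,0,0,0,0,0,0,0,0,9,0,0,13,0,0,0,12] [316,0,500,0,0,0,500,75])
 (Split 4 68
 (Leaf [137,46,300,13,0,0,0,150,12,2,0,0,0,0,0,0,0,0,0,0,0,0,0,0,0,0,0,11] [0,46,300,0,0,0,293,50])
 (Split 5 (-34)
 (Leaf [7556,4296,20000,3782,0,1620,0,12322,736,32,0,0,0,0,0,500,0,0,0,0,0,0,0,56,0,0,0,574]
[3,612,0,0,-3782,-1620,16509]) (Split 4 79
 (Leaf [2756,484,5000,49,0,0,0,2805,200,26,109,0,0,0,0,0,0,0,0,0,0,108,0,0,0,0,0,121]
[1,305,4984,0,-49,0,4976,650])
 (Leaf [1976,887,5000,887,0,0,0,2854,200,0,31,0,0,0,0,88,0,0,0,0,0,46,0,0,0,0,0,133]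
[0,887,2155,-991,-887,0,4557])))))))))))
 (Leaf [143,72,300,0,143,0,0,0,12,13,0,0,0,0,0,6,0,0,0,0,2,13,0,0,0,0,0,12]
[0,72,300,-625,143,0,300,325])) (Split 5 (-40)
 (Leaf [133,0,300,0,0,100,0,200,8,0,0,0,0,0,0,0,0,0,0,0,0,0,0,3] [0,0,0,0,0,-100,200])
 (Split 5 (-20) (Split 12 86
 (Leaf [229,49,500,49,0,0,0,274,21,0,7,0,0,0,0,0,0,0,0,0,7,1,0,0,0,0,0,12] [0,39,387,0,-39,0,491])
 (Split 1 26
 (Leaf [13946,1930,20000,0,0,0,0,13946,800,105,0,0,0,0,0,0,0,0,0,0,241,0,0,486,0,0,0,483]
[10125,0,19970,0,0,0,20000,2625]) (Split 4 68
 (Leaf [133,44,300,13,0,0,0,145,12,2,0,0,0,0,0,0,0,0,0,0,0,0,0,0,0,0,0,11]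
[0,44,300,0,-13,0,294,50]) (Split 2 68
 (Leaf [139,41,300,41,0,0,0,178,12,0,0,0,0,0,0,0,0,0,0,0,0,0,0,0,0,0,0,10] [0,41,172,0,-41,0,280])
 (Split 12 88 (Leaf [2524,449,5000,449,0,0,0,2952,205,0,98,0,0,0,0,0,0,0,0,0,2,67,0,0,0,0,0,112]
[0,7,3389,-20,-449,0,4900]) (Split 5 (-34)
 (Leaf [1889,336,5000,36,0,900,0,2524,164,18,0,0,0,0,0,0,0,0,0,0,85,0,0,73,0,0,0,84]
[0,10,0,0,-36,-900,4082]) (Split 5 (-26) (Split 12 89
 (Leaf [734,421,2000,421,0,0,0,1146,81,0,0,0,0,0,0,44,0,0,0,0,3,9,0,0,0,0,0,61]
[0,421,1363,0,-400,0,1804]) (Split 2 79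
 (Leaf [170,46,500,46,0,0,0,215,20,0,0,0,0,0,0,0,0,0,0,0,12,0,0,3,0,0,0,11]
[0,46,54,-282,-46,0,477]) (Split 4 79
 (Leaf [9341,1713,20000,1713,0,0,0,11035,800,0,350,0,0,0,0,0,0,0,0,0,0,320,0,0,0,0,0,428]
[0,0,9936,0,-1713,0,19144]) (Split 1 36
 (Leaf [377,233,1000,233,0,0,0,608,40,0,0,0,0,0,0,27,0,0,0,0,0,1,0,0,0,0,0,31]
[10,152,928,0,-223,0,883])
 (Leaf [903,140,2000,121,0,57,0,1061,78,1,40,0,0,0,0,0,0,0,0,0,0,41,0,0,0,0,0,35]
[0,140,20,-914,-120,-57,1889])))))
 (Leaf [889,168,2000,7,0,0,0,896,80,9,32,0,0,0,0,0,0,0,0,0,0,46,0,0,0,0,0,42]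
[0,168,2000,-1329,0,0,1996,225]))))))))
 (Leaf [70,35,200,0,70,0,0,0,8,6,0,0,0,0,0,3,0,0,0,0,0,6,0,0,0,0,0,6]
[3,35,200,-350,70,0,200,150])))))))))) (Split 5 (-45)
 (Leaf [1000,0,2000,0,0,577,0,1423,57] [0,0,0,0,0,-577,1425]) (Split 4 45
 (Leaf [75,25,200,0,0,0,0,75,8,1,0,0,0,0,0,0,0,0,0,0,0,0,0,0,0,0,0,6] [0,0,150,0,0,0,200,25])
 (Split 2 45
 (Leaf [150,25,200,0,0,0,0,150,8,1,0,0,0,0,0,0,0,0,0,0,0,0,0,0,0,0,0,6] [0,0,150,0,0,0,200,25])
 (Split 1 14 (Leaf [743,60,1000,60,0,0,0,794,40,0,0,0,0,0,0,0,0,0,0,0,3,0,0,11,0,0,0,15]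
[486,10,1000,0,-60,0,970]) (Split 13 78 (Split 12 83
 (Leaf [1969,475,5000,55,0,1144,0,2855,167,23,45,0,0,0,0,0,0,0,0,0,0,40,0,0,0,0,0,119]
[0,475,3249,0,-54,-1138,4147]) (Split 5 (-34)
 (Leaf [1889,0,5000,0,0,1795,0,3205,128,0,0,0,0,0,0,0,0,0,0,0,0,0,0,24] [0,0,0,0,0,-1795,3200])
 (Split 5 (-17) (Split 12 86
 (Leaf [435,105,1000,105,0,0,0,531,42,0,10,0,0,0,0,0,0,0,0,0,10,7,0,0,0,0,0,26]
[0,105,940,0,-105,0,997]) (Split 13 72 (Split 1 32 (Split 2 68
 (Leaf [500,119,1000,105,0,38,0,628,39,1,0,0,0,0,0,0,0,0,0,0,0,0,0,0,0,0,0,30]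
[0,119,1000,0,-105,-38,922]) (Split 12 88
 (Leaf [843,178,2000,93,0,232,0,1102,72,5,22,0,0,0,0,0,0,0,0,0,24,0,0,4,0,0,0,44]
[0,0,1999,0,-93,-232,1754]) (Split 1 23
 (Leaf [110,16,200,16,0,0,0,126,8,0,0,0,0,0,0,0,0,0,0,0,2,0,0,4,0,0,0,4] [110,0,200,0,-16,0,192])
 (Split 4 68
 (Leaf [51,17,128,17,0,0,0,68,5,0,0,0,0,0,0,0,0,0,0,0,0,0,0,0,0,0,0,4] [0,17,128,0,-17,0,117])
 (Split 4 79 (Leaf [880,169,2000,108,0,167,0,1108,73,3,31,0,0,0,0,0,0,0,0,0,0,0,0,0,0,0,0,42]
[0,0,2000,0,-108,-167,1771]) (Split 5 (-26)
 (Leaf [1444,623,5000,0,0,1700,0,2691,132,34,0,0,0,0,0,57,0,0,0,0,23,0,0,22,0,0,0,98]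
[0,312,0,0,0,-1700,3300])
 (Leaf [1832,628,5000,404,0,610,0,2674,176,12,40,0,0,0,0,45,0,0,0,0,0,56,0,0,0,0,0,112]
[10,628,5000,-2026,-404,-610,4198])))))))
 (Leaf [5353,986,20000,0,0,5123,0,9110,595,54,200,0,0,0,0,0,0,0,0,0,0,194,0,0,0,0,0,246]
[0,979,0,-9,0,-5123,14875]))
 (Leaf [378,161,2000,0,0,831,0,1043,47,8,0,0,0,0,0,13,0,0,0,0,0,0,0,4,0,0,0,27]
[0,27,3,0,0,-831,1175]))) (Leaf [82,20,300,0,0,0,0,82,12,1,2,0,0,0,0,0,0,0,0,0,0,5,0,0,0,0,0,5]
[0,20,300,-186,0,0,300,25])))) (Leaf [0,0,500,0,0,226,0,196,11] [0,0,0,0,0,-226,275]))))))))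
 (Split 5 (-62)
 (Leaf [88,4,128,4,0,0,0,91,5,0,0,0,0,0,0,0,0,0,0,0,2,0,0,4,0,0,0,1] [0,0,0,0,-4,0,123])
 (Split 4 45 (Leaf [0,0,24,0,0,0,0,0,1] [0,0,0,0,0,0,25]) (Split 5 (-31)
 (Leaf [2253,322,5000,322,0,0,0,2525,201,0,107,0,0,0,0,0,0,0,0,0,0,99,0,0,0,0,0,80]
[0,322,0,0,-322,0,4864])
 (Leaf [0,0,200,0,0,0,0,0,8,0,0,0,0,0,0,0,0,0,0,0,0,6] [0,0,0,-200,0,0,200])))))) (Split 13 54
 (Leaf [8,48,24,0,8,0,0,0,1,4,0,0,0,0,2,0,0,0,0,0,0,0,0,0,0,0,2] [8,48,24,-101,8,0,25,100])
 (Split 13 72 (Split 4 45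
 (Leaf [32,200,95,0,32,0,0,0,4,12,0,0,0,3,0,0,0,0,0,0,0,0,0,0,0,0,8] [32,197,95,-213,32,0,100,300])
 (Leaf [29,131,200,0,29,0,0,0,8,8,0,0,0,3,0,3,0,0,0,0,0,7,0,0,0,0,7] [1,131,200,-400,29,0,200,200]))
 (Split 2 45 (Split 5 30
 (Leaf [24,72,96,0,24,0,0,0,4,4,0,0,0,0,0,0,0,0,0,0,0,0,1,0,0,0,6] [0,72,96,-104,24,0,100,100])
 (Leaf [50,200,17,0,50,0,0,0,1,10,0,0,0,0,0,0,0,0,0,0,0,0,0,0,0,0,0,0,4]
[0,200,17,-258,50,0,25,250])) (Split 12 76 (Split 5 45
 (Leaf [158,474,1000,0,0,0,158,0,55,19,0,0,0,0,0,0,0,13,0,0,0,0,0,0,0,0,39]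
[0,474,1000,-902,0,158,1375,475])
 (Leaf [42,300,211,0,0,0,42,0,12,12,0,0,0,0,0,0,0,5,5,0,0,0,0,0,11,0,11]
[42,300,211,-600,0,42,300,300])) (Split 1 30
 (Leaf [300,100,300,0,300,0,0,0,12,16,0,0,0,0,0,0,0,0,0,0,0,0,0,0,0,0,0,25]
[0,100,300,-600,300,0,300,400]) (Split 13 81 (Split 4 45 (Split 5 45
 (Leaf [131,300,300,0,131,0,0,0,12,19,0,0,8,0,0,0,0,0,0,0,0,0,0,0,0,0,25]
[75,297,297,-178,131,0,300,475])
 (Leaf [0,24,0,0,0,0,0,0,0,1,0,0,0,0,0,0,0,0,0,0,0,0,0,0,0,1] [0,0,0,-25,0,0,0,25])) (Split 5 38
 (Leaf [18,117,1000,0,18,0,0,0,40,6,0,0,0,5,0,0,0,0,0,0,0,0,24,0,0,0,4]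
[0,117,362,-1150,18,0,1000,150])
 (Leaf [32,96,56,0,32,0,0,0,2,6,0,0,3,3,0,0,0,0,0,0,0,0,0,0,0,0,5] [32,96,56,-200,32,0,50,150])))
 (Split 5 14
 (Leaf [11,36,200,0,11,0,0,0,8,2,0,0,0,0,0,0,0,0,0,0,0,0,1,0,0,0,3] [0,36,200,-47,11,0,200,50])
 (Split 1 60 (Split 5 52 (Split 4 39
 (Leaf [66,200,198,0,66,0,0,0,8,11,0,0,0,0,0,0,0,0,0,0,0,0,0,0,0,0,16]
[0,200,198,-175,66,0,200,275])
 (Leaf [18,54,200,0,18,0,0,0,8,3,0,0,0,0,0,0,0,0,0,0,0,0,0,0,0,0,4] [0,54,200,-250,18,0,200,75]))
 (Leaf [23,128,70,0,23,0,0,0,3,6,0,0,0,0,0,0,0,0,0,0,0,0,0,0,4,0,6] [23,128,70,-225,23,0,75,150]))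
 (Split 4 45 (Split 5 52 (Split 4 16
 (Leaf [24,300,99,0,24,0,0,0,4,13,0,0,0,0,0,0,0,2,0,0,0,0,0,0,0,4,6] [24,188,99,-3,24,0,100,325])
 (Split 12 83 (Leaf [145,300,280,0,0,0,145,0,18,12,0,0,13,0,0,0,0,0,0,0,0,0,0,0,0,2,23]
[71,290,273,-327,0,145,450,300]) (Split 5 25
 (Leaf [795,3546,5000,0,795,0,0,0,200,174,0,0,0,97,0,0,0,0,0,0,0,0,141,0,0,0,199]
[10,3546,4002,-23,795,0,5000,4350]) (Split 13 86
 (Leaf [130,300,253,0,130,0,0,0,10,18,0,0,11,0,0,0,0,0,0,0,0,0,0,0,0,4,21]
[129,300,253,-350,130,0,250,450]) (Split 12 87 (Split 4 27
 (Leaf [45,300,220,0,0,0,45,0,11,12,0,0,0,0,0,0,0,7,0,0,0,0,0,0,0,8,11]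
[42,300,220,-107,0,45,275,300])
 (Leaf [113,200,195,0,0,0,113,0,13,8,0,0,12,0,0,0,0,0,0,0,0,0,0,0,0,0,16]
[45,200,195,-339,0,113,325,200])) (Split 2 67
 (Leaf [97,500,292,0,97,0,0,0,12,24,0,0,0,0,0,0,0,0,0,0,0,0,0,0,0,0,24]
[97,500,292,-492,97,0,300,600]) (Split 13 88 (Split 4 30
 (Leaf [608,2000,1073,0,608,0,0,0,43,107,0,0,63,0,0,0,0,0,0,0,0,0,0,0,0,44,89]
[608,0,1073,-2266,608,0,1075,2675])
 (Leaf [176,292,300,0,176,0,0,0,12,19,0,0,20,0,0,0,0,0,0,0,0,0,1,0,0,0,24]
[62,272,290,-545,176,0,300,475])) (Split 12 89 (Split 4 29
 (Leaf [663,5000,3435,0,0,0,663,0,166,200,0,0,0,0,0,0,0,121,0,0,0,0,0,0,0,189,166]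
[647,7,3435,-5209,0,663,4150,5000]) (Split 5 36
 (Leaf [498,866,1000,0,0,0,498,0,61,35,0,0,52,0,0,0,0,0,0,0,0,0,11,0,0,0,72]
[52,866,1000,-1111,0,498,1525,875])
 (Leaf [223,500,449,0,0,0,223,0,27,20,0,0,24,0,0,0,0,5,0,0,0,0,0,0,0,9,32]
[220,426,439,-1113,0,223,675,500]))) (Split 4 31 (Split 5 35
 (Leaf [8334,20000,18048,0,8334,0,0,0,722,1133,0,0,757,0,0,0,0,178,0,0,0,0,0,0,0,340,1326]
[8324,12320,18048,0,8334,0,18050,28325])
 (Leaf [2045,20000,12530,0,2045,0,0,0,501,882,0,0,0,0,0,0,0,533,0,0,0,0,0,0,0,744,511]
[2035,3,12530,-26931,2045,0,12525,22050])) (Split 5 39 (Split 1 75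
 (Leaf [117,352,500,0,117,0,0,0,20,19,0,0,0,0,0,0,0,0,0,0,0,0,0,0,0,0,29]
[117,352,500,-454,117,0,500,475]) (Split 4 38
 (Leaf [1195,1922,2000,0,1195,0,0,0,80,125,0,0,139,0,0,0,0,0,0,0,0,0,6,0,0,0,160]
[45,1912,2000,-2099,1195,0,2000,3125])
 (Leaf [255,1692,2000,0,255,0,0,0,80,78,0,0,0,77,0,0,0,0,0,0,0,0,93,0,0,0,64]
[0,1692,10,-3950,255,0,2000,1950])))
 (Leaf [133,484,500,0,133,0,0,0,20,25,0,0,9,0,0,0,0,17,0,0,0,0,0,0,0,16,24]
[133,484,500,-1125,133,0,500,625])))))))))))
 (Leaf [0,200,0,0,0,0,0,0,0,8,0,0,0,0,0,0,0,0,0,0,0,0,0,0,0,7] [0,32,0,-200,0,0,0,200]))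
 (Split 5 36 (Leaf [0,0,200,0,0,0,0,0,8,0,0,0,0,0,0,0,0,0,0,0,0,0,7] [0,0,0,-143,0,0,200])
 (Leaf [36,264,300,0,36,0,0,0,12,12,0,0,0,13,0,0,0,0,0,0,0,0,13,0,0,0,9]
[0,264,300,-600,36,0,300,300]))))))))))))))))"

lemma level3_check: "check level3_products level3_constraints level3_box level3_cert"
  by code_simp

section \<open>The third Schur complement\<close>

lemma level3_normalised:
  fixes M :: "nat \<Rightarrow> nat \<Rightarrow> real" and s R p q :: real
  assumes M00: "M 0 0 = 1" and M1: "\<And>i j. i < 3 \<Longrightarrow> j < 3 \<Longrightarrow> \<bar>M i j\<bar> \<le> 1"
    and blk: "\<And>i i' j j' e e' f f'. \<lbrakk>i < 3; i' < 3; j < 3; j' < 3;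
        e \<in> {1, -1}; e' \<in> {1, -1}; f \<in> {1, -1}; f' \<in> {1, -1}\<rbrakk> \<Longrightarrow>
      3 * (e * f * M i j) + 3 * (e * f' * M i j') + 3 * (e' * f * M i' j) - e' * f' * M i' j' \<le> 81/4 * s"
    and s: "4/9 \<le> s" "s \<le> 42/90"
    and nonneg: "0 \<le> M 0 1" "0 \<le> M 1 0"
    and R: "R = M 1 0 * M 0 1 - M 1 1" "1 \<le> R"
    and p: "p = M 1 2 - M 1 0 * M 0 2" "0 \<le> p" "p \<le> R"
    and q: "q = M 2 1 - M 2 0 * M 0 1" "0 \<le> q" "q \<le> R"
    and P: "M 2 2 - M 2 0 * M 0 2 \<le> R"
  shows "M 2 2 - M 2 0 * M 0 2 + p * q / R \<le> 121/25 * s"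
proof (rule ccontr)
  assume neg: "\<not> ?thesis"
  define z c where "z = p / R" and "c = q / R"
  let ?xs = "map ((*) 90) [s, M 0 1, M 1 0, - M 1 1, - M 0 2, - M 2 0, M 1 2, M 2 1, M 2 2, R, p, q, z, c]"
  have le1: "M 0 1 \<le> 1" "M 1 0 \<le> 1" using M1[of 0 1] M1[of 1 0] by auto
  \<comment> \<open>Together with R \<ge> 1 this forces the middle entry to be nonpositive, which is
    why the box can take m \<ge> 0.\<close>
  then have "M 1 0 * M 0 1 \<le> 1" using nonneg by (simp add: mult_le_one)
  then have m: "0 \<le> - M 1 1" "R \<le> 2" using R M1[of 1 1] by auto
  have "in_box level3_box ?xs"
    using s nonneg le1 m R(2) p(2,3) q(2,3) M1[of 0 2] M1[of 2 0] M1[of 1 1] M1[of 1 2] M1[of 2 1] M1[of 2 2]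
    by (simp add: in_box_def level3_box_def abs_le_iff z_def c_def divide_le_eq)
  moreover have "\<forall>(i, j)\<in>set level3_products. i < length ?xs \<and> j < length ?xs"
    by (simp add: level3_products_def)
  moreover have "\<forall>c\<in>set level3_constraints. 0 \<le> quad_eval level3_products c ?xs"
  proof -
    have "R \<le> M 1 0 * M 0 1 - M 1 1" "p \<le> M 1 2 - M 1 0 * M 0 2" "q \<le> M 2 1 - M 2 0 * M 0 1"
      using R p q by simp_all
    moreover have "121/25 * s \<le> M 2 2 - M 2 0 * M 0 2 + z * q" "121/25 * s \<le> M 2 2 - M 2 0 * M 0 2 + c * p"
      using neg by (simp_all add: z_def c_def mult.commute)
    moreover have "z * R \<le> p" "p \<le> z * R" "c * R \<le> q" "q \<le> c * R" "M 2 2 - M 2 0 * M 0 2 \<le> R"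
      using R(2) P by (simp_all add: z_def c_def)
    ultimately show ?thesis
      using M00
        blk[of 1 0 0 1 1 1 1 "-1"] blk[of 0 1 1 0 1 "-1" 1 1] blk[of 0 1 0 1 1 1 1 1]
        blk[of 1 0 0 2 1 1 1 1] blk[of 0 1 2 0 1 "-1" "-1" 1] blk[of 0 1 0 2 1 1 1 "-1"]
        blk[of 1 0 1 2 1 "-1" "-1" 1] blk[of 0 2 1 0 1 1 1 1] blk[of 0 2 0 1 1 "-1" 1 1]
        blk[of 2 0 0 2 1 "-1" "-1" 1] blk[of 0 2 2 0 1 "-1" "-1" 1] blk[of 2 0 2 1 1 "-1" 1 1]
        blk[of 2 0 1 2 1 1 1 1] blk[of 1 2 1 0 1 "-1" "-1" 1] blk[of 2 1 2 0 1 1 1 "-1"]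
        blk[of 1 2 2 0 1 1 1 1] blk[of 2 1 2 1 1 1 1 1] blk[of 2 1 1 2 1 "-1" 1 1]
        blk[of 1 2 2 1 1 1 1 "-1"]
      by (simp add: quad_eval_def products_def level3_products_def level3_constraints_def algebra_simps)
  qed
  ultimately show False using check_sound[OF level3_check, of ?xs] by simp
qed

text \<open>Both hypotheses and conclusion are invariant under sign changes of rows and columns.
  Keeping row and column 0 fixed leaves four signs, which are spent on making \<open>M 0 1\<close>,
  \<open>- P 1 1\<close>, \<open>P 1 2\<close> and \<open>P 2 1\<close> nonnegative.\<close>

theorem level3_bound:
  fixes M :: "nat \<Rightarrow> nat \<Rightarrow> real" and s :: real
  defines "P \<equiv> \<lambda>i j. M i j - M i 0 * M 0 j"
  assumes M00: "M 0 0 = 1" and M1: "\<And>i j. i < 3 \<Longrightarrow> j < 3 \<Longrightarrow> \<bar>M i j\<bar> \<le> 1"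
    and blk: "\<And>i i' j j' e e' f f'. \<lbrakk>i < 3; i' < 3; j < 3; j' < 3;
        e \<in> {1, -1}; e' \<in> {1, -1}; f \<in> {1, -1}; f' \<in> {1, -1}\<rbrakk> \<Longrightarrow>
      3 * (e * f * M i j) + 3 * (e * f' * M i j') + 3 * (e' * f * M i' j) - e' * f' * M i' j' \<le> 81/4 * s"
    and s: "4/9 \<le> s" "s \<le> 42/90"
    and P1: "\<bar>P 1 2\<bar> \<le> \<bar>P 1 1\<bar>" "\<bar>P 2 1\<bar> \<le> \<bar>P 1 1\<bar>" "\<bar>P 2 2\<bar> \<le> \<bar>P 1 1\<bar>" and P11: "P 1 1 \<noteq> 0"
  shows "\<bar>P 2 2 - P 2 1 * P 1 2 / P 1 1\<bar> \<le> 121/25 * s"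
proof -
  define R where "R = \<bar>P 1 1\<bar>"
  have prod: "\<bar>P 2 1 * P 1 2 / P 1 1\<bar> \<le> R"
  proof -
    have "\<bar>P 2 1\<bar> * \<bar>P 1 2\<bar> \<le> \<bar>P 1 1\<bar> * \<bar>P 1 1\<bar>" using P1 by (intro mult_mono) auto
    then show ?thesis using P11 by (simp add: R_def abs_mult divide_le_eq)
  qed
  show ?thesis
  proof (cases "R \<le> 1")
    case True
    \<comment> \<open>Here both terms are at most 1, and 2 < 121/25 * 4/9.\<close>
    then show ?thesis
      using abs_triangle_ineq4[of "P 2 2" "P 2 1 * P 1 2 / P 1 1"] prod P1(3) s unfolding R_def by linarith
  next
    case False
    define \<sigma> where "\<sigma> z = (if z < 0 then -1 else 1 :: real)" for z :: real
    have \<sigma>: "\<sigma> z \<in> {1, -1}" "\<sigma> z * z = \<bar>z\<bar>" "\<sigma> z * \<sigma> z = 1" for z by (auto simp: \<sigma>_def)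
    define f1 where "f1 = \<sigma> (M 0 1)"
    define e1 where "e1 = - \<sigma> (P 1 1) * f1"
    define f2 where "f2 = e1 * \<sigma> (P 1 2)"
    define e2 where "e2 = f1 * \<sigma> (P 2 1)"
    have sgn: "f1 \<in> {1, -1}" "e1 \<in> {1, -1}" "f2 \<in> {1, -1}" "e2 \<in> {1, -1}"
      unfolding f1_def e1_def f2_def e2_def by (intro sign_mult sign_minus \<sigma>(1))+
    have sq: "f1 * f1 = 1" "e1 * e1 = 1" "f2 * f2 = 1" "e2 * e2 = 1" using sgn by auto
    define E F where "E i = (if i = 0 then 1 else if i = 1 then e1 else e2)"
      and "F i = (if i = 0 then 1 else if i = 1 then f1 else f2)" for i :: nat
    have EF: "E i \<in> {1, -1}" "F i \<in> {1, -1}" for i using sgn by (auto simp: E_def F_def)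
    define M' where "M' i j = E i * F j * M i j" for i j
    have M'P: "M' i j - M' i 0 * M' 0 j = E i * F j * P i j" for i j
      by (simp add: M'_def P_def E_def F_def algebra_simps)
    have R: "R = M' 1 0 * M' 0 1 - M' 1 1"
    proof -
      have "M' 1 1 - M' 1 0 * M' 0 1 = - (f1 * f1) * (\<sigma> (P 1 1) * P 1 1)"
        unfolding M'P by (simp add: E_def F_def e1_def)
      then show ?thesis by (simp add: sq \<sigma>(2) R_def)
    qed
    have p: "M' 1 2 - M' 1 0 * M' 0 2 = \<bar>P 1 2\<bar>"
    proof -
      have "M' 1 2 - M' 1 0 * M' 0 2 = (e1 * e1) * (\<sigma> (P 1 2) * P 1 2)"
        unfolding M'P by (simp add: E_def F_def f2_def)
      then show ?thesis by (simp add: sq \<sigma>(2))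
    qed
    have q: "M' 2 1 - M' 2 0 * M' 0 1 = \<bar>P 2 1\<bar>"
    proof -
      have "M' 2 1 - M' 2 0 * M' 0 1 = (f1 * f1) * (\<sigma> (P 2 1) * P 2 1)"
        unfolding M'P by (simp add: E_def F_def e2_def)
      then show ?thesis by (simp add: sq \<sigma>(2))
    qed
    have M1': "\<bar>M' i j\<bar> \<le> 1" if "i < 3" "j < 3" for i j
      using M1[OF that] EF(1)[of i] EF(2)[of j] by (auto simp: M'_def)
    have u: "0 \<le> M' 0 1" by (simp add: M'_def E_def F_def f1_def \<sigma>(2))
    have v: "0 \<le> M' 1 0"
    proof (rule ccontr)
      assume "\<not> 0 \<le> M' 1 0"
      \<comment> \<open>No sign is left for this entry, but none is needed: R > 1 and \<bar>M' 1
        1\<bar> \<le> 1 leave a positive product \<open>M' 1 0 * M' 0 1\<close>.\<close>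
      then have "M' 1 0 * M' 0 1 \<le> 0" using u by (simp add: mult_le_0_iff)
      then show False using R False M1'[of 1 1] by simp
    qed
    have R2: "R \<le> 2"
    proof -
      have "M' 1 0 * M' 0 1 \<le> 1" using u v M1'[of 1 0] M1'[of 0 1] by (simp add: mult_le_one)
      then show ?thesis using R M1'[of 1 1] by simp
    qed
    have blk': "3 * (e * f * M' i j) + 3 * (e * f' * M' i j') + 3 * (e' * f * M' i' j) - e' * f' * M' i' j'
        \<le> 81/4 * s"
      if "i < 3" "i' < 3" "j < 3" "j' < 3" "e \<in> {1, -1}" "e' \<in> {1, -1}" "f \<in> {1, -1}" "f' \<in> {1, -1}"
      for i i' j j' e e' f f'
    proof -
      show ?thesis
        using blk[OF that(1-4) sign_mult[OF that(5) EF(1)[of i]] sign_mult[OF that(6) EF(1)[of i']]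
            sign_mult[OF that(7) EF(2)[of j]] sign_mult[OF that(8) EF(2)[of j']]]
        by (simp add: M'_def algebra_simps)
    qed
    have M00': "M' 0 0 = 1" by (simp add: M'_def E_def F_def M00)
    have P22: "M' 2 2 - M' 2 0 * M' 0 2 \<le> R"
      unfolding M'P using P1(3) sgn by (auto simp: E_def F_def R_def)
    have main: "M' 2 2 - M' 2 0 * M' 0 2 + \<bar>P 1 2\<bar> * \<bar>P 2 1\<bar> / R \<le> 121/25 * s"
      by (rule level3_normalised[OF M00' M1' blk' s u v R _ p[symmetric] _ _ q[symmetric] _ _ P22])
        (use False P1 in \<open>auto simp: R_def\<close>)
    have "\<bar>P 1 2\<bar> * \<bar>P 2 1\<bar> / R = - (e2 * f2 * (P 2 1 * P 1 2 / P 1 1))"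
    proof -
      have "R = - (E 1 * F 1 * P 1 1)" using R M'P[of 1 1] by linarith
      moreover have "\<bar>P 1 2\<bar> = e1 * f2 * P 1 2" "\<bar>P 2 1\<bar> = e2 * f1 * P 2 1"
        using p q unfolding M'P by (simp_all add: E_def F_def)
      ultimately show ?thesis using sgn P11 by (auto simp: E_def F_def)
    qed
    then have eq: "e2 * f2 * (P 2 2 - P 2 1 * P 1 2 / P 1 1) = e2 * f2 * P 2 2 + \<bar>P 1 2\<bar> * \<bar>P 2 1\<bar> / R"
      by (simp add: algebra_simps)
    \<comment> \<open>The sign of the last diagonal entry is already determined, so the lower bound
      is separate: the added quotient is nonnegative, and - R \<ge> - 2 is above - 121/25 s.\<close>
    have "0 \<le> \<bar>P 1 2\<bar> * \<bar>P 2 1\<bar> / R" by (simp add: R_def)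
    moreover have "- R \<le> e2 * f2 * P 2 2" using P1(3) sgn by (auto simp: R_def)
    moreover have "e2 * f2 * P 2 2 + \<bar>P 1 2\<bar> * \<bar>P 2 1\<bar> / R \<le> 121/25 * s"
      using main unfolding M'P by (simp add: E_def F_def)
    ultimately have "\<bar>e2 * f2 * (P 2 2 - P 2 1 * P 1 2 / P 1 1)\<bar> \<le> 121/25 * s"
      using R2 s unfolding eq by linarith
    then show ?thesis using sgn by (auto simp: abs_minus_commute)
  qed
qed

section \<open>Elimination steps\<close>

text \<open>The pivot indices \<open>k\<close>, \<open>l\<close> and the remaining indices
  \<open>I\<close> are arbitrary, since the same normal form serves steps one and two as well as
  three and four. The minus signs in front of the first row and column, with the signs in
  \<open>x\<close> and \<open>y\<close>, turn the subtraction in the second step into an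
  addition.\<close>

lemma normal_form:
  fixes T T' T'' :: "nat \<Rightarrow> nat \<Rightarrow> real"
  assumes p: "T k k \<noteq> 0"
    and T': "\<And>i j. T' i j = T i j - T i k * T k j / T k k"
    and T'': "\<And>i j. T'' i j = T' i j - T' i l * T' l j / T' l l"
    and bound: "\<And>i j. i \<in> insert k (insert l I) \<Longrightarrow> j \<in> insert k (insert l I) \<Longrightarrow> \<bar>T i j\<bar> \<le> \<bar>T k k\<bar>"
    and bound': "\<And>i j. i \<in> insert l I \<Longrightarrow> j \<in> insert l I \<Longrightarrow> \<bar>T' i j\<bar> \<le> \<bar>T' l l\<bar>"
    and r: "r = \<bar>T' l l / T k k\<bar>" "1 < r"
  obtains u v x y where "pivot_ok r u v"
    and "\<And>i. i \<in> I \<Longrightarrow> row_ok r u (- (T i k / T k k)) (x i)"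
    and "\<And>j. j \<in> I \<Longrightarrow> row_ok r v (- (T k j / T k k)) (y j)"
    and "\<And>i j. i \<in> I \<Longrightarrow> j \<in> I \<Longrightarrow> entry_ok r (- (T i k / T k k)) (- (T k j / T k k)) (T' i j / T k k)"
    and "\<And>i j. T'' i j / T k k = T' i j / T k k + x i * y j / r"
proof -
  define \<sigma> where "\<sigma> z = (if z < 0 then -1 else 1 :: real)" for z :: real
  have \<sigma>: "\<sigma> z \<in> {1, -1}" "\<sigma> z * z = \<bar>z\<bar>" "\<sigma> z * \<sigma> z = 1" for z by (auto simp: \<sigma>_def)
  define c where "c i j = T i j / T k k" for i j
  define b where "b i = T i k / T k k" for i
  define a where "a j = T k j / T k k" for j
  define C where "C i j = T' i j / T k k" for i j
  have C: "C i j = c i j - b i * a j" for i j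
    using p by (simp add: C_def T' c_def b_def a_def diff_divide_distrib)
  have c1: "\<bar>c i j\<bar> \<le> 1" if "i \<in> insert k (insert l I)" "j \<in> insert k (insert l I)" for i j
    using bound[OF that] p by (simp add: c_def)
  have b1: "\<bar>b i\<bar> \<le> 1" "\<bar>a i\<bar> \<le> 1" if "i \<in> insert k (insert l I)" for i
    using bound[of i k] bound[of k i] that p by (simp_all add: b_def a_def)
  have C1: "\<bar>C i j\<bar> \<le> r" if "i \<in> insert l I" "j \<in> insert l I" for i j
    using bound'[OF that] p by (simp add: C_def r(1) divide_right_mono)
  define e where "e = \<sigma> (C l l)"
  define f where "f = \<sigma> (e * b l)"
  have ef: "e \<in> {1, -1}" "f \<in> {1, -1}" using \<sigma>(1) by (auto simp: e_def f_def)
  have er: "e * C l l = r" unfolding e_def \<sigma>(2) by (simp add: r(1) C_def)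
  define u v where "u = \<bar>a l\<bar>" and "v = \<bar>b l\<bar>"
  have fv: "f * e * b l = v"
  proof -
    have "f * (e * b l) = \<bar>e * b l\<bar>" unfolding f_def by (rule \<sigma>(2))
    moreover have "\<bar>e * b l\<bar> = v" using ef(1) by (auto simp: v_def)
    ultimately show ?thesis by (simp add: mult.assoc)
  qed
  have rl: "r = e * c l l - v * (f * a l)"
  proof -
    have "v * (f * a l) = (f * f) * (e * (b l * a l))" by (simp add: fv[symmetric] algebra_simps)
    also have "f * f = 1" using ef by auto
    finally show ?thesis using er C[of l l] by (simp add: algebra_simps)
  qed
  have ec: "e * c l l \<le> 1" using c1[of l l] ef by auto
  \<comment> \<open>This is where r > 1 matters: the original diagonal entry has absolute value at
    most 1, so the correction has to be positive, which fixes the relative sign of row and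
    column.\<close>
  have "v * (f * a l) < 0" using rl ec r(2) by linarith
  then have "f * a l < 0" by (simp add: v_def mult_less_0_iff)
  then have fu: "f * a l = - u" using ef by (auto simp: u_def)
  define x where "x i = - f * C i l" for i
  define y where "y j = f * e * C l j" for j
  show thesis
  proof (rule that[of u v x y])
    show "pivot_ok r u v"
      using rl ec fu b1[of l] by (simp add: pivot_ok_def u_def v_def mult.commute)
  next
    fix i assume i: "i \<in> I"
    have "x i - u * (- b i) = - f * c i l + b i * (f * a l + u)"
      by (simp add: x_def C algebra_simps)
    then have "\<bar>x i - u * (- b i)\<bar> \<le> 1" using c1[of i l] i ef by (auto simp: fu)
    then show "row_ok r u (- (T i k / T k k)) (x i)"
      using b1[of i] C1[of i l] i ef by (auto simp: row_ok_def b_def[symmetric] x_def)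
  next
    fix j assume j: "j \<in> I"
    have "y j - v * (- a j) = f * e * c l j"
      by (simp add: y_def C fv[symmetric] algebra_simps)
    then have "\<bar>y j - v * (- a j)\<bar> \<le> 1" using c1[of l j] j ef by auto
    then show "row_ok r v (- (T k j / T k k)) (y j)"
      using b1[of j] C1[of l j] j ef by (auto simp: row_ok_def a_def[symmetric] y_def)
  next
    fix i j assume "i \<in> I" "j \<in> I"
    then show "entry_ok r (- (T i k / T k k)) (- (T k j / T k k)) (T' i j / T k k)"
      using C1[of i j] c1[of i j] C[of i j]
      by (simp add: entry_ok_def a_def[symmetric] b_def[symmetric] C_def[symmetric])
  next
    fix i j
    have "T'' i j / T k k = C i j - C i l * C l j / C l l"
      using p by (simp add: T'' C_def diff_divide_distrib)
    also have "C l l = e * r" using er ef by auto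
    finally show "T'' i j / T k k = T' i j / T k k + x i * y j / r"
      using ef by (auto simp: x_def y_def C_def)
  qed
qed

text \<open>The bound is kept as an alternative depending on r, not flattened to 9/4, because a
  third pivot above twice the first must later confine r. If r \<le> 1, one elimination step at most
  doubles the entries.\<close>

lemma second_complement_bound:
  fixes T T' T'' :: "nat \<Rightarrow> nat \<Rightarrow> real"
  assumes p: "T k k \<noteq> 0" "T' l l \<noteq> 0"
    and T': "\<And>i j. T' i j = T i j - T i k * T k j / T k k"
    and T'': "\<And>i j. T'' i j = T' i j - T' i l * T' l j / T' l l"
    and bound: "\<And>i j. i \<in> insert k (insert l I) \<Longrightarrow> j \<in> insert k (insert l I) \<Longrightarrow> \<bar>T i j\<bar> \<le> \<bar>T k k\<bar>"
    and bound': "\<And>i j. i \<in> insert l I \<Longrightarrow> j \<in> insert l I \<Longrightarrow> \<bar>T' i j\<bar> \<le> \<bar>T' l l\<bar>"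
    and ij: "i \<in> I" "j \<in> I"
  defines "r \<equiv> \<bar>T' l l / T k k\<bar>"
  shows "\<bar>T'' i j\<bar> \<le> 2 * \<bar>T k k\<bar> \<or> 1 < r \<and> \<bar>T'' i j\<bar> \<le> (3 * r - r\<^sup>2) * \<bar>T k k\<bar>"
proof (cases "1 < r")
  case True
  obtain u v x y where n: "pivot_ok r u v"
    "\<And>i. i \<in> I \<Longrightarrow> row_ok r u (- (T i k / T k k)) (x i)"
    "\<And>j. j \<in> I \<Longrightarrow> row_ok r v (- (T k j / T k k)) (y j)"
    "\<And>i j. i \<in> I \<Longrightarrow> j \<in> I \<Longrightarrow> entry_ok r (- (T i k / T k k)) (- (T k j / T k k)) (T' i j / T k k)"
    "\<And>i j. T'' i j / T k k = T' i j / T k k + x i * y j / r"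
    using normal_form[OF p(1) T' T'' bound bound' r_def[THEN meta_eq_to_obj_eq] True] by blast
  have "u * v \<le> 1" using n(1) by (auto simp: pivot_ok_def mult_le_one)
  then have "r \<le> 2" using n(1) by (simp add: pivot_ok_def)
  then have "\<bar>T'' i j / T k k\<bar> \<le> 3 * r - r\<^sup>2"
    using entry_bound[OF _ _ n(1) n(2)[OF ij(1)] n(3)[OF ij(2)] n(4)[OF ij]] True by (simp add: n(5))
  then show ?thesis using True p by (simp add: divide_le_eq abs_divide)
next
  case False
  have "\<bar>T' i l * T' l j / T' l l\<bar> \<le> \<bar>T' l l\<bar>"
  proof -
    have "\<bar>T' i l\<bar> * \<bar>T' l j\<bar> \<le> \<bar>T' l l\<bar> * \<bar>T' l l\<bar>" using bound' ij by (intro mult_mono) auto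
    then show ?thesis using p by (simp add: abs_mult divide_le_eq)
  qed
  then have "\<bar>T'' i j\<bar> \<le> 2 * \<bar>T' l l\<bar>"
    using bound'[of i j] ij abs_triangle_ineq4[of "T' i j" "T' i l * T' l j / T' l l"] by (simp add: T'')
  moreover have "\<bar>T' l l\<bar> \<le> \<bar>T k k\<bar>" using False p by (simp add: r_def abs_divide not_less divide_le_eq)
  ultimately show ?thesis by linarith
qed

lemma parabola_le: "3 * r - r\<^sup>2 \<le> (9/4 :: real)"
  using zero_le_power2[of "r - 3/2"] by (simp add: power2_eq_square algebra_simps)

text \<open>9/4 - 484/225 = 89/900 is slightly below (19/60)^2, and 3/2 - 19/60 = 71/60, 3/2 + 19/60
  = 109/60.\<close>

lemma parabola_range:
  fixes r :: real
  assumes "484/225 < 3 * r - r\<^sup>2"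
  shows "71/60 \<le> r" "r \<le> 109/60"
proof -
  have "(r - 3/2)\<^sup>2 < (19/60)\<^sup>2"
    using assms by (simp add: power2_eq_square algebra_simps)
  then have "\<bar>r - 3/2\<bar> < 19/60" by (intro power2_less_imp_less[of "\<bar>r - 3/2\<bar>"]) auto
  then show "71/60 \<le> r" "r \<le> 109/60" unfolding abs_less_iff by linarith+
qed

theorem fifth_pivot_bound:
  fixes S :: "nat \<Rightarrow> nat \<Rightarrow> nat \<Rightarrow> real"
  assumes step: "\<And>k i j. S (Suc k) i j = S k i j - S k i k * S k k j / S k k k"
    and nz: "\<And>k. k < 4 \<Longrightarrow> S k k k \<noteq> 0"
    and bound: "\<And>k i j. \<lbrakk>k < 4; k \<le> i; i < 5; k \<le> j; j < 5\<rbrakk> \<Longrightarrow> \<bar>S k i j\<bar> \<le> \<bar>S k k k\<bar>"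
  shows "\<bar>S 4 4 4\<bar> \<le> 121/25 * \<bar>S 0 0 0\<bar>" and "\<bar>S 2 2 2\<bar> \<le> 9/4 * \<bar>S 0 0 0\<bar>"
proof -
  have S1: "S (Suc 0) i j = S 0 i j - S 0 i 0 * S 0 0 j / S 0 0 0" for i j by (rule step)
  have S2: "S 2 i j = S (Suc 0) i j - S (Suc 0) i (Suc 0) * S (Suc 0) (Suc 0) j / S (Suc 0) (Suc 0) (Suc 0)" for i j
    using step[of "Suc 0" i j] by (simp add: numeral_2_eq_2)
  have S3: "S 3 i j = S 2 i j - S 2 i 2 * S 2 2 j / S 2 2 2" for i j
    using step[of 2 i j] by (simp add: numeral_3_eq_3 numeral_2_eq_2)
  have S4: "S 4 i j = S 3 i j - S 3 i 3 * S 3 3 j / S 3 3 3" for i j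
    using step[of 3 i j] by (simp add: eval_nat_numeral)
  define r where "r = \<bar>S (Suc 0) (Suc 0) (Suc 0) / S 0 0 0\<bar>"
  define p where "p = \<bar>S 0 0 0\<bar>"
  have p: "0 < p" using nz[of 0] by (simp add: p_def)
  have two: "\<bar>S 2 i j\<bar> \<le> 2 * p \<or> 1 < r \<and> \<bar>S 2 i j\<bar> \<le> (3 * r - r\<^sup>2) * p"
    if "i \<in> {2, 3, 4}" "j \<in> {2, 3, 4}" for i j
    unfolding r_def p_def
    by (rule second_complement_bound[OF _ _ S1 S2 _ _ that]) (use nz bound in auto)
  have quarter: "(3 * r - r\<^sup>2) * p \<le> 9/4 * p" using p parabola_le by (intro mult_right_mono) auto
  show p3: "\<bar>S 2 2 2\<bar> \<le> 9/4 * \<bar>S 0 0 0\<bar>"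
  proof -
    have "\<bar>S 2 2 2\<bar> \<le> 2 * p \<or> \<bar>S 2 2 2\<bar> \<le> (3 * r - r\<^sup>2) * p" using two[of 2 2] by auto
    then show ?thesis using quarter p unfolding p_def[symmetric] by (elim disjE) linarith+
  qed
  have p5: "\<bar>S 4 4 4\<bar> \<le> 9/4 * \<bar>S 2 2 2\<bar>"
  proof -
    define r' where "r' = \<bar>S 3 3 3 / S 2 2 2\<bar>"
    have "\<bar>S 4 4 4\<bar> \<le> 2 * \<bar>S 2 2 2\<bar> \<or> 1 < r' \<and> \<bar>S 4 4 4\<bar> \<le> (3 * r' - r'\<^sup>2) * \<bar>S 2 2 2\<bar>"
      unfolding r'_def
      by (rule second_complement_bound[OF _ _ S3 S4 _ _, of "{4}"]) (use nz bound in auto)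
    moreover have "(3 * r' - r'\<^sup>2) * \<bar>S 2 2 2\<bar> \<le> 9/4 * \<bar>S 2 2 2\<bar>"
      using parabola_le by (intro mult_right_mono) auto
    ultimately show ?thesis by (elim disjE conjE) linarith+
  qed
  show "\<bar>S 4 4 4\<bar> \<le> 121/25 * \<bar>S 0 0 0\<bar>"
  proof (rule ccontr)
    assume "\<not> ?thesis"
    then have big: "121/25 * p < \<bar>S 4 4 4\<bar>" by (simp add: p_def)
    then have big3: "484/225 * p < \<bar>S 2 2 2\<bar>" using p5 by linarith
    \<comment> \<open>484/225 exceeds 2, so only the alternative with r > 1 survives.\<close>
    then have "\<not> \<bar>S 2 2 2\<bar> \<le> 2 * p" using p by linarith
    then have r1: "1 < r" and le: "\<bar>S 2 2 2\<bar> \<le> (3 * r - r\<^sup>2) * p" using two[of 2 2] by auto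
    have "484/225 * p < (3 * r - r\<^sup>2) * p" using big3 le by linarith
    then have "484/225 < 3 * r - r\<^sup>2" using p by (simp only: mult_less_cancel_right_pos)
    note r = parabola_range[OF this]
    have nz2: "S 2 2 2 \<noteq> 0" "S 0 0 0 \<noteq> 0" using nz by auto
    have b0: "\<bar>S 0 i j\<bar> \<le> \<bar>S 0 0 0\<bar>"
      if "i \<in> insert 0 (insert (Suc 0) {2, 3, 4})" "j \<in> insert 0 (insert (Suc 0) {2, 3, 4})" for i j
      using bound[of 0 i j] that by auto
    have b1: "\<bar>S (Suc 0) i j\<bar> \<le> \<bar>S (Suc 0) (Suc 0) (Suc 0)\<bar>"
      if "i \<in> insert (Suc 0) {2, 3, 4}" "j \<in> insert (Suc 0) {2, 3, 4}" for i j
      using bound[of "Suc 0" i j] that by auto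
    obtain u v x y where n: "pivot_ok r u v"
      "\<And>i. i \<in> {2, 3, 4} \<Longrightarrow> row_ok r u (- (S 0 i 0 / S 0 0 0)) (x i)"
      "\<And>j. j \<in> {2, 3, 4} \<Longrightarrow> row_ok r v (- (S 0 0 j / S 0 0 0)) (y j)"
      "\<And>i j. i \<in> {2, 3, 4} \<Longrightarrow> j \<in> {2, 3, 4} \<Longrightarrow>
         entry_ok r (- (S 0 i 0 / S 0 0 0)) (- (S 0 0 j / S 0 0 0)) (S (Suc 0) i j / S 0 0 0)"
      "\<And>i j. S 2 i j / S 0 0 0 = S (Suc 0) i j / S 0 0 0 + x i * y j / r"
      using normal_form[OF nz2(2) S1 S2 b0 b1 r_def r1] by blast
    define t where "t = S 0 0 0 / S 2 2 2"
    define s where "s = \<bar>t\<bar>"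
    define M where "M i j = S 2 (i + 2) (j + 2) / S 2 2 2" for i j
    have M: "M i j = t * (S 2 (i + 2) (j + 2) / S 0 0 0)" for i j
      using nz2 by (simp add: M_def t_def)
    have blk: "3 * (e * f * M i j) + 3 * (e * f' * M i j') + 3 * (e' * f * M i' j) - e' * f' * M i' j'
        \<le> 81/4 * s"
      if ij: "i < 3" "i' < 3" "j < 3" "j' < 3"
        and sg: "e \<in> {1, -1}" "e' \<in> {1, -1}" "f \<in> {1, -1}" "f' \<in> {1, -1}" for i i' j j' e e' f f'
    proof -
      \<comment> \<open>Dividing by the third pivot may reverse all entries; this sign is moved into
        the row signs e and e'.\<close>
      define \<tau> where "\<tau> = (if t < 0 then -1 else 1 :: real)"
      have \<tau>: "t = s * \<tau>" "\<tau> \<in> {1, -1}" by (auto simp: \<tau>_def s_def)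
      have idx: "i + 2 \<in> {2, 3, 4}" "i' + 2 \<in> {2, 3, 4}" "j + 2 \<in> {2, 3, 4}" "j' + 2 \<in> {2, 3, 4}"
        using ij by auto
      have "3 * (\<tau> * e * f * (S 2 (i + 2) (j + 2) / S 0 0 0)) + 3 * (\<tau> * e * f' * (S 2 (i + 2) (j' + 2) / S 0 0 0))
          + 3 * (\<tau> * e' * f * (S 2 (i' + 2) (j + 2) / S 0 0 0)) - \<tau> * e' * f' * (S 2 (i' + 2) (j' + 2) / S 0 0 0)
          \<le> 81/4"
        unfolding n(5)
        by (rule block_bound[OF r n(1) n(2)[OF idx(1)] n(2)[OF idx(2)] n(3)[OF idx(3)] n(3)[OF idx(4)]
              n(4)[OF idx(1) idx(3)] n(4)[OF idx(1) idx(4)] n(4)[OF idx(2) idx(3)] n(4)[OF idx(2) idx(4)]])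
          (use sg \<tau>(2) in auto)
      then have "s * (3 * (\<tau> * e * f * (S 2 (i + 2) (j + 2) / S 0 0 0)) + 3 * (\<tau> * e * f' * (S 2 (i + 2) (j' + 2) / S 0 0 0))
          + 3 * (\<tau> * e' * f * (S 2 (i' + 2) (j + 2) / S 0 0 0)) - \<tau> * e' * f' * (S 2 (i' + 2) (j' + 2) / S 0 0 0))
          \<le> s * (81/4)"
        by (intro mult_left_mono) (auto simp: s_def)
      then show ?thesis unfolding M \<tau>(1) by (simp add: algebra_simps)
    qed
    \<comment> \<open>The upper bound 225/484 is rounded up to a multiple of 1/90.\<close>
    have s: "4/9 \<le> s" "s \<le> 42/90"
      using p3 big3 nz2 by (simp_all add: s_def t_def p_def abs_divide divide_simps)
    have M1: "\<bar>M i j\<bar> \<le> 1" if "i < 3" "j < 3" for i j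
      using bound[of 2 "i + 2" "j + 2"] that nz2 by (simp add: M_def)
    have P: "M i j - M i 0 * M 0 j = S 3 (i + 2) (j + 2) / S 2 2 2" for i j
      using nz2 by (simp add: M_def S3 diff_divide_distrib del: add_2_eq_Suc add_2_eq_Suc')
    have idx: "(0::nat) + 2 = 2" "(1::nat) + 2 = 3" "(2::nat) + 2 = 4" by simp_all
    note PV = P[of 1 1, unfolded idx] P[of 1 2, unfolded idx] P[of 2 1, unfolded idx] P[of 2 2, unfolded idx]
    have M00: "M 0 0 = 1" using M_def[of 0 0, unfolded idx] nz2 by simp
    have S3b: "\<bar>S 3 i j / S 2 2 2\<bar> \<le> \<bar>S 3 3 3 / S 2 2 2\<bar>" if "i \<in> {3, 4}" "j \<in> {3, 4}" for i j
      using bound[of 3 i j] that by (auto simp: abs_divide intro!: divide_right_mono)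
    have nz3: "S 3 3 3 / S 2 2 2 \<noteq> 0" using nz[of 3] nz2 by simp
    have "\<bar>S 3 4 4 / S 2 2 2 - S 3 4 3 / S 2 2 2 * (S 3 3 4 / S 2 2 2) / (S 3 3 3 / S 2 2 2)\<bar> \<le> 121/25 * s"
      by (rule level3_bound[of M s, unfolded PV])
        (rule M00, (rule M1; assumption), (rule blk; assumption), rule s(1), rule s(2), (rule S3b; simp)+, rule nz3)
    moreover have "S 3 4 4 / S 2 2 2 - S 3 4 3 / S 2 2 2 * (S 3 3 4 / S 2 2 2) / (S 3 3 3 / S 2 2 2)
        = S 4 4 4 / S 2 2 2"
      using nz2 nz[of 3] by (simp add: S4 diff_divide_distrib)
    ultimately have "\<bar>S 4 4 4 / S 2 2 2\<bar> \<le> 121/25 * s" by simp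
    then have "\<bar>S 4 4 4\<bar> \<le> 121/25 * p"
      using nz2 by (simp add: s_def t_def p_def abs_divide divide_simps)
    then show False using big by simp
  qed
qed

section \<open>Gaussian elimination and LU factorisations\<close>

text \<open>Pivoting is expressed through \<open>schur\<close>, which inverts a leading block,
  whereas the pivot bounds need the update by a single step. Both are identified below with tails of
  the product L U. Row and column labels are kept here, while \<open>schur\<close> restarts them at
  0.\<close>

fun elimination :: "(nat \<Rightarrow> nat \<Rightarrow> real) \<Rightarrow> nat \<Rightarrow> nat \<Rightarrow> nat \<Rightarrow> real" where
  "elimination a 0 i j = a i j"
| "elimination a (Suc k) i j =
     elimination a k i j - elimination a k i k * elimination a k k j / elimination a k k k"

locale lu_factorisation =
  fixes A L U :: "real mat" and n :: nat
  assumes A: "A \<in> carrier_mat n n" and L: "L \<in> carrier_mat n n" and U: "U \<in> carrier_mat n n"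
    and minors: "leading_minors_invertible A"
    and lower: "unit_lower_triangular L" and upper: "upper_triangular U"
    and LU: "A = L * U"
begin

lemma L_above: "i < j \<Longrightarrow> j < n \<Longrightarrow> L $$ (i, j) = 0"
  and L_diag: "i < n \<Longrightarrow> L $$ (i, i) = 1"
  using lower L by (auto simp: unit_lower_triangular_def)

lemma U_below: "j < i \<Longrightarrow> i < n \<Longrightarrow> U $$ (i, j) = 0"
  using upper U by (auto simp: upper_triangular_def)

lemma A_entry: "i < n \<Longrightarrow> j < n \<Longrightarrow> A $$ (i, j) = (\<Sum>l<n. L $$ (i, l) * U $$ (l, j))"
  using L U by (auto simp: LU scalar_prod_def lessThan_atLeast0)

lemma A_entry_low:
  assumes "i < n" "j < n" "i < k \<or> j < k" "k \<le> n"
  shows "A $$ (i, j) = (\<Sum>l<k. L $$ (i, l) * U $$ (l, j))"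
proof -
  have "(\<Sum>l<n. L $$ (i, l) * U $$ (l, j)) = (\<Sum>l<k. L $$ (i, l) * U $$ (l, j))"
    using assms by (intro sum.mono_neutral_right) (auto simp: L_above U_below)
  then show ?thesis using A_entry assms by simp
qed

text \<open>The leading block of A is the product of the leading blocks of L and U, so the block of
  U times the inverse is a right inverse of the block of L, and for square matrices also a left
  inverse. The empty block is treated separately because the minor condition starts at size
  1.\<close>

lemma leading_inverse:
  assumes k: "k < n"
  obtains X where "X \<in> carrier_mat k k" "mat_inv (subm A 0 k 0 k) = X"
    "subm U 0 k 0 k * X * subm L 0 k 0 k = 1\<^sub>m k"
proof -
  let ?A = "subm A 0 k 0 k" and ?L = "subm L 0 k 0 k" and ?U = "subm U 0 k 0 k"
  have car: "?A \<in> carrier_mat k k" "?L \<in> carrier_mat k k" "?U \<in> carrier_mat k k"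
    by (auto simp: subm_def)
  have prod: "?A = ?L * ?U"
    using k by (intro eq_matI) (auto simp: subm_def scalar_prod_def A_entry_low[of _ _ k] lessThan_atLeast0)
  have "\<exists>B. B \<in> carrier_mat k k \<and> ?A * B = 1\<^sub>m k \<and> B * ?A = 1\<^sub>m k"
  proof (cases "k = 0")
    case True
    then show ?thesis using car by (intro exI[of _ "1\<^sub>m 0"]) auto
  next
    case False
    then have "invertible_mat ?A" using minors k A by (auto simp: leading_minors_invertible_def)
    then obtain B where B: "?A * B = 1\<^sub>m (dim_row ?A)" "B * ?A = 1\<^sub>m (dim_row B)"
      by (auto simp: invertible_mat_def inverts_mat_def)
    have "dim_col B = k" using arg_cong[OF B(1), of dim_col] car by simp
    moreover have "dim_row B = k" using arg_cong[OF B(2), of dim_col] car by simp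
    ultimately show ?thesis using B car by (intro exI[of _ B]) auto
  qed
  then obtain B where "B \<in> carrier_mat (dim_row ?A) (dim_row ?A) \<and> ?A * B = 1\<^sub>m (dim_row ?A) \<and>
      B * ?A = 1\<^sub>m (dim_row ?A)" using car by auto
  then have X: "mat_inv ?A \<in> carrier_mat k k" "?A * mat_inv ?A = 1\<^sub>m k"
    using someI[of "\<lambda>B. B \<in> carrier_mat (dim_row ?A) (dim_row ?A) \<and> ?A * B = 1\<^sub>m (dim_row ?A) \<and>
      B * ?A = 1\<^sub>m (dim_row ?A)"] car by (auto simp: mat_inv_def)
  have "?L * (?U * mat_inv ?A) = 1\<^sub>m k"
    using X car by (simp add: prod assoc_mult_mat[of _ k k _ k _ k])
  then have "?U * mat_inv ?A * ?L = 1\<^sub>m k"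
    using X car by (intro mat_mult_left_right_inverse[of ?L k]) auto
  then show thesis using X that by blast
qed

lemma U_diag_nonzero:
  assumes "Suc k < n"
  shows "U $$ (k, k) \<noteq> 0"
proof
  assume zero: "U $$ (k, k) = 0"
  obtain X where X: "X \<in> carrier_mat (Suc k) (Suc k)"
    "subm U 0 (Suc k) 0 (Suc k) * X * subm L 0 (Suc k) 0 (Suc k) = 1\<^sub>m (Suc k)"
    using leading_inverse[OF assms] by metis
  let ?Y = "X * subm L 0 (Suc k) 0 (Suc k)"
  have Y: "?Y \<in> carrier_mat (Suc k) (Suc k)" using X by (auto simp: subm_def)
  have "subm U 0 (Suc k) 0 (Suc k) * ?Y = 1\<^sub>m (Suc k)"
    using X by (subst assoc_mult_mat[symmetric, of _ "Suc k" "Suc k" _ "Suc k"]) (auto simp: subm_def)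
  then have "(subm U 0 (Suc k) 0 (Suc k) * ?Y) $$ (k, k) = 1" by simp
  moreover have "(subm U 0 (Suc k) 0 (Suc k) * ?Y) $$ (k, k) = (\<Sum>l = 0..<Suc k. U $$ (k, l) * ?Y $$ (l, k))"
    using Y by (auto simp: subm_def scalar_prod_def)
  \<comment> \<open>Below the diagonal U vanishes, and its diagonal entry is zero by assumption, so
    a whole row of an invertible block would be zero.\<close>
  moreover have "(\<Sum>l = 0..<Suc k. U $$ (k, l) * ?Y $$ (l, k)) = 0"
    using zero assms U_below[of _ k] by (intro sum.neutral) (auto simp: less_Suc_eq)
  ultimately show False by simp
qed

text \<open>The inverse cancels in L21 U11 X L11 U12, leaving L21 U12. Subtracting this from A
  removes the first k summands of the matrix product.\<close>

lemma schur_entry: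
  assumes k: "k < n" and i: "i < n - k" and j: "j < n - k"
  shows "schur A k $$ (i, j) = (\<Sum>l = k..<n. L $$ (k + i, l) * U $$ (l, k + j))"
proof -
  obtain X where X: "X \<in> carrier_mat k k" "mat_inv (subm A 0 k 0 k) = X"
    "subm U 0 k 0 k * X * subm L 0 k 0 k = 1\<^sub>m k"
    using leading_inverse[OF k] by metis
  let ?L11 = "subm L 0 k 0 k" and ?U11 = "subm U 0 k 0 k" and ?L21 = "subm L k n 0 k" and ?U12 = "subm U 0 k k n"
  have car: "?L11 \<in> carrier_mat k k" "?U11 \<in> carrier_mat k k" "?L21 \<in> carrier_mat (n - k) k"
    "?U12 \<in> carrier_mat k (n - k)" by (auto simp: subm_def)
  have A21: "subm A k n 0 k = ?L21 * ?U11"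
    using k by (intro eq_matI) (auto simp: subm_def scalar_prod_def A_entry_low[of _ _ k] lessThan_atLeast0)
  have A12: "subm A 0 k k n = ?L11 * ?U12"
    using k by (intro eq_matI) (auto simp: subm_def scalar_prod_def A_entry_low[of _ _ k] lessThan_atLeast0)
  have "subm A k n 0 k * X * subm A 0 k k n = ?L21 * ((?U11 * X * ?L11) * ?U12)"
  proof -
    have UX: "?U11 * X \<in> carrier_mat k k" and LU: "?L11 * ?U12 \<in> carrier_mat k (n - k)"
      using car X(1) by auto
    show ?thesis
      unfolding A21 A12 assoc_mult_mat[OF car(3,2) X(1)] assoc_mult_mat[OF car(3) UX LU]
        assoc_mult_mat[OF UX car(1,4)] ..
  qed
  also have "\<dots> = ?L21 * ?U12" using X(3) car by simp
  finally have "schur A k = subm A k n k n - ?L21 * ?U12"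
    using A X(2) by (simp add: schur_def Let_def)
  then have "schur A k $$ (i, j) = A $$ (k + i, k + j) - (\<Sum>l<k. L $$ (k + i, l) * U $$ (l, k + j))"
    using i j by (simp add: subm_def scalar_prod_def lessThan_atLeast0)
  also have "A $$ (k + i, k + j) = (\<Sum>l<k. L $$ (k + i, l) * U $$ (l, k + j))
      + (\<Sum>l = k..<n. L $$ (k + i, l) * U $$ (l, k + j))"
    using i j k by (simp add: A_entry lessThan_atLeast0 sum.atLeastLessThan_concat)
  finally show ?thesis by simp
qed

lemma tail_sum_column:
  assumes "k < n"
  shows "(\<Sum>l = k..<n. L $$ (i, l) * U $$ (l, k)) = L $$ (i, k) * U $$ (k, k)"
proof -
  have "(\<Sum>l = k..<n. L $$ (i, l) * U $$ (l, k)) = (\<Sum>l\<in>{k}. L $$ (i, l) * U $$ (l, k))"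
    using assms by (intro sum.mono_neutral_right) (auto simp: U_below)
  then show ?thesis by simp
qed

lemma tail_sum_row:
  assumes "k < n"
  shows "(\<Sum>l = k..<n. L $$ (k, l) * U $$ (l, j)) = U $$ (k, j)"
proof -
  have "(\<Sum>l = k..<n. L $$ (k, l) * U $$ (l, j)) = (\<Sum>l\<in>{k}. L $$ (k, l) * U $$ (l, j))"
    using assms by (intro sum.mono_neutral_right) (auto simp: L_above)
  then show ?thesis using L_diag assms by simp
qed

text \<open>One update removes exactly the summand l = k: by triangularity the pivot column and row
  reduce to single terms, and dividing by U (k, k) leaves L (i, k) U (k, j).\<close>

lemma elimination_entry:
  assumes "k < n" "k \<le> i" "i < n" "k \<le> j" "j < n"
  shows "elimination (\<lambda>i j. A $$ (i, j)) k i j = (\<Sum>l = k..<n. L $$ (i, l) * U $$ (l, j))"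
  using assms
proof (induction k arbitrary: i j)
  case 0
  then show ?case by (simp add: A_entry lessThan_atLeast0)
next
  case (Suc k)
  have nz: "U $$ (k, k) \<noteq> 0" using U_diag_nonzero Suc by auto
  have e: "elimination (\<lambda>i j. A $$ (i, j)) k i' j' = (\<Sum>l = k..<n. L $$ (i', l) * U $$ (l, j'))"
    if "i' \<in> {k, i}" "j' \<in> {k, j}" for i' j' using Suc that by auto
  have "elimination (\<lambda>i j. A $$ (i, j)) (Suc k) i j
      = (\<Sum>l = k..<n. L $$ (i, l) * U $$ (l, j)) - L $$ (i, k) * U $$ (k, j)"
    using Suc nz by (simp add: e tail_sum_column tail_sum_row L_diag)
  also have "\<dots> = (\<Sum>l = Suc k..<n. L $$ (i, l) * U $$ (l, j))"
    using Suc by (simp add: sum.atLeast_Suc_lessThan)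
  finally show ?case .
qed

end

section \<open>Maximum norms and the growth factor\<close>

lemma max_norm_le:
  assumes "M \<in> carrier_mat m n" "0 < m" "0 < n" "\<And>i j. i < m \<Longrightarrow> j < n \<Longrightarrow> \<bar>M $$ (i, j)\<bar> \<le> c"
  shows "max_norm M \<le> c"
proof -
  have "{\<bar>M $$ (i, j)\<bar> |i j. i < dim_row M \<and> j < dim_col M}
      = (\<lambda>(i, j). \<bar>M $$ (i, j)\<bar>) ` ({..<m} \<times> {..<n})"
    using assms(1) by auto
  then show ?thesis unfolding max_norm_def using assms by (subst Max_le_iff) auto
qed

lemma abs_le_max_norm:
  assumes "M \<in> carrier_mat m n" "i < m" "j < n"
  shows "\<bar>M $$ (i, j)\<bar> \<le> max_norm M"
proof -
  have "{\<bar>M $$ (i, j)\<bar> |i j. i < dim_row M \<and> j < dim_col M}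
      = (\<lambda>(i, j). \<bar>M $$ (i, j)\<bar>) ` ({..<m} \<times> {..<n})"
    using assms(1) by auto
  then show ?thesis unfolding max_norm_def using assms by (intro Max_ge) auto
qed

theorem theorem2:
  fixes A L U :: "real mat"
  assumes "A \<in> carrier_mat 5 5"
    and "leading_minors_invertible A"
    and "completely_pivoted A"
    and "L \<in> carrier_mat 5 5" and "U \<in> carrier_mat 5 5"
    and "unit_lower_triangular L" and "upper_triangular U"
    and "A = L * U"
  shows "growth_factor A L U \<le> 4.84"
proof -
  interpret lu_factorisation A L U 5
    using assms by unfold_locales auto
  define S where "S = elimination (\<lambda>i j. A $$ (i, j))"
  have step: "S (Suc k) i j = S k i j - S k i k * S k k j / S k k k" for k i j by (simp add: S_def)
  have S: "S k i j = (\<Sum>l = k..<5. L $$ (i, l) * U $$ (l, j))"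
    if "k \<le> i" "i < 5" "k \<le> j" "j < 5" for k i j
    using elimination_entry[of k i j] that by (simp add: S_def)
  have Sk: "S k k j = U $$ (k, j)" if "k \<le> j" "j < 5" for k j using S[of k k j] that tail_sum_row[of k j] by simp
  have Sc: "S k i k = L $$ (i, k) * U $$ (k, k)" if "k \<le> i" "i < 5" for k i
    using S[of k i k] that tail_sum_column[of k i] by simp
  have nz: "S k k k \<noteq> 0" if "k < 4" for k using that Sk[of k k] U_diag_nonzero[of k] by simp
  have bound: "\<bar>S k i j\<bar> \<le> \<bar>S k k k\<bar>" if k: "k < 4" and i: "k \<le> i" "i < 5" and j: "k \<le> j" "j < 5" for k i j
  proof -
    \<comment> \<open>The shift by k translates between the two index conventions.\<close>
    have "S k i' j' = schur A k $$ (i' - k, j' - k)" if "k \<le> i'" "i' < 5" "k \<le> j'" "j' < 5" for i' j'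
      using S[OF that] schur_entry[of k "i' - k" "j' - k"] that k by (auto simp: less_diff_conv2)
    moreover have "\<bar>schur A k $$ (i - k, j - k)\<bar> \<le> \<bar>schur A k $$ (0, 0)\<bar>"
      using assms(1,3) k diff_less_mono[OF i(2,1)] diff_less_mono[OF j(2,1)]
      by (auto simp: completely_pivoted_def)
    ultimately show ?thesis using i j k by simp
  qed
  have double: "\<bar>S (Suc k) (Suc k) (Suc k)\<bar> \<le> 2 * \<bar>S k k k\<bar>" if k: "k < 4" for k
  proof -
    have "\<bar>S k (Suc k) k\<bar> * \<bar>S k k (Suc k)\<bar> \<le> \<bar>S k k k\<bar> * \<bar>S k k k\<bar>"
      using bound[of k] k by (intro mult_mono) auto
    then have "\<bar>S k (Suc k) k * S k k (Suc k) / S k k k\<bar> \<le> \<bar>S k k k\<bar>"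
      using nz[OF k] by (simp add: abs_mult divide_le_eq)
    then show ?thesis
      using bound[of k "Suc k" "Suc k"] k
        abs_triangle_ineq4[of "S k (Suc k) (Suc k)" "S k (Suc k) k * S k k (Suc k) / S k k k"]
      by (simp add: step)
  qed
  have pivots: "\<bar>S k k k\<bar> \<le> 4.84 * \<bar>S 0 0 0\<bar>" if "k < 5" for k
  proof -
    have "\<bar>S 1 1 1\<bar> \<le> 2 * \<bar>S 0 0 0\<bar>" "\<bar>S 3 3 3\<bar> \<le> 2 * \<bar>S 2 2 2\<bar>"
      using double[of 0] double[of 2] by (simp_all add: numeral_3_eq_3 numeral_2_eq_2)
    moreover have "\<bar>S 4 4 4\<bar> \<le> 121/25 * \<bar>S 0 0 0\<bar>" "\<bar>S 2 2 2\<bar> \<le> 9/4 * \<bar>S 0 0 0\<bar>"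
      by (rule fifth_pivot_bound; (rule step | rule nz | rule bound); assumption)+
    moreover have "k = 0 \<or> k = 1 \<or> k = 2 \<or> k = 3 \<or> k = 4" using that by linarith
    \<comment> \<open>The second and third pivots are harmless, and the fourth is at most 2 * 9/4 =
      4.5 times the first.\<close>
    ultimately show ?thesis using abs_ge_zero[of "S 0 0 0"] by (elim disjE) (simp; linarith)+
  qed
  have U_le: "\<bar>U $$ (i, j)\<bar> \<le> 4.84 * \<bar>S 0 0 0\<bar>" if "i < 5" "j < 5" for i j
  proof (cases "i \<le> j")
    case True
    have "\<bar>S i i j\<bar> \<le> \<bar>S i i i\<bar>"
    proof (cases "i < 4")
      case False
      \<comment> \<open>Pivoting says nothing about the last step, but row 4 of U then contains only
        the pivot itself.\<close>
      then have "i = 4" "j = 4" using that True by auto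
      then show ?thesis by simp
    qed (use bound that True in auto)
    then show ?thesis using Sk[of i j] True that pivots[of i] by simp
  next
    case False
    then show ?thesis using U_below[of j i] that by simp
  qed
  have L_le: "\<bar>L $$ (i, j)\<bar> \<le> 1" if "i < 5" "j < 5" for i j
  proof -
    consider "i < j" | "i = j" | "j < i" by linarith
    then show ?thesis
    proof cases
      case 3
      \<comment> \<open>Before step j the entry below the pivot is L (i, j) times the pivot, so
        complete pivoting bounds the multiplier by 1.\<close>
      then have "\<bar>L $$ (i, j)\<bar> * \<bar>S j j j\<bar> \<le> 1 * \<bar>S j j j\<bar>"
        using bound[of j i j] Sc[of j i] Sk[of j j] that by (simp add: abs_mult)
      then show ?thesis using nz[of j] 3 that by (simp only: mult_le_cancel_right) simp
    qed (use that L_above L_diag in auto)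
  qed
  have "max_norm L \<le> 1" using max_norm_le[OF assms(4)] L_le by simp
  moreover have "max_norm U / max_norm A \<le> 4.84"
  proof -
    have "S 0 0 0 = A $$ (0, 0)" by (simp add: S_def)
    then have A0: "\<bar>S 0 0 0\<bar> \<le> max_norm A" using abs_le_max_norm[OF assms(1), of 0 0] by simp
    moreover have "0 < \<bar>S 0 0 0\<bar>" using nz[of 0] by simp
    ultimately have "0 < max_norm A" by linarith
    moreover have "max_norm U \<le> 4.84 * \<bar>S 0 0 0\<bar>" by (rule max_norm_le[OF assms(5)]) (use U_le in auto)
    ultimately show ?thesis using A0 by (simp add: pos_divide_le_eq)
  qed
  ultimately show ?thesis by (simp add: growth_factor_def)
qed

end
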